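(* Let $S$ be a string of length $n$ that is the coordinate-wise concatenation of an $\varepsilon_s$-synchronization string of length $n$ and a near-linear-time $\varepsilon_I$-indexing sequence $I$ of length $n$. Assume that $S$ goes through a channel that may impose up to $\delta n$ symbol deletions and $\gamma n$ symbol insertions on $S$, for some $0\le\delta<1$ and $0\le\gamma$, and arrives as $S'$ at the receiving end of the channel. For every positive integer $K$, there exists a decoding for $S'$ that runs in $O(Kn\,\mathrm{poly}(\log n))$ time, guarantees at most $$n\left(\frac{1+\gamma}{K(1+\varepsilon_I)}+\frac{\varepsilon_I(1+\gamma/2)}{1+\varepsilon_I}+K\varepsilon_s\right)$$ misdecodings, and does not decode more than $K$ received symbols to any one number in $[1,n]$.
   Context: $\mathrm{ED}(A,B)$ is the minimum number of single-character insertions and deletions (no substitutions) needed to transform $A$ into $B$. The coordinate-wise concatenation $A\times B$ of two strings of length $n$ is the length-$n$ string whose $i$-th symbol is $(A_i,B_i)$. A string $T\in\Sigma^n$ is an $\varepsilon_s$-synchronization string if for all $1\le i<j<k\le n+1$, $\mathrm{ED}(T[i,j),T[j,k))>(1-\varepsilon_s)(k-i)$, where $T[i,j)$ is the substring at positions $i,\dots,j-1$. A near-linear-time $\varepsilon_I$-indexing sequence ($\varepsilon_I\in(0,1)$) is a string $I\in\Sigma_I^n$, $|\Sigma_I|$ depending only on $\varepsilon_I$, equipped with an algorithm which, given $T\times I$ for any string $T$ of length $n$ over any alphabet $\Sigma$ and any string $S''$ over $\Sigma\times\Sigma_I$ (of arbitrary length $O(n)$), outputs in $O_{\varepsilon_I}(n\,\mathrm{poly}(\log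 n))$ time a set of at most $(1+\varepsilon_I)\,\mathrm{ED}(T\times I,S'')$ symbol insertions and deletions turning $T\times I$ into $S''$. A decoding for $S'$ is an algorithm that knows $S$, receives $S'$, and outputs for each position of $S'$ either an element of $[1,n]$ (a guess of the position in $S$ of the symbol) or the symbol $\bot$ (undecoded). A misdecoding is a symbol $S[i]$ that is not deleted by the channel, arriving as the symbol at some position $j$ of $S'$, such that position $j$ of $S'$ is not decoded as $i$. The misdecoding bound is for every possible channel behaviour (pattern of at most $\delta n$ deletions and at most $\gamma n$ insertions). The $O(\cdot)$ in the running time hides constants depending on $\varepsilon_I$ and $\gamma$. *)

theory Defs
  imports Complex_Main "HOL-Library.Landau_Symbols"
begin

text \<open>Positions in strings are counted from 0 throughout, so position \<open>i\<close> here is position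
  \<open>i + 1\<close> of the mathematical text.\<close>

section \<open>Edit distance and synchronization strings\<close>

inductive edit_step :: "'a list \<Rightarrow> 'a list \<Rightarrow> bool" where
  insertion: "edit_step (xs @ ys) (xs @ a # ys)"
| deletion: "edit_step (xs @ a # ys) (xs @ ys)"

definition ED :: "'a list \<Rightarrow> 'a list \<Rightarrow> nat" where
  "ED A B = (LEAST k. (edit_step ^^ k) A B)"

definition substring :: "'a list \<Rightarrow> nat \<Rightarrow> nat \<Rightarrow> 'a list" where
  "substring T i j = take (j - i) (drop i T)"

definition sync_string :: "real \<Rightarrow> 'a list \<Rightarrow> bool" where
  "sync_string \<epsilon> T \<longleftrightarrow>
     (\<forall>i j k. i < j \<and> j < k \<and> k \<le> length T \<longrightarrow>
        real (ED (substring T i j) (substring T j k)) > (1 - \<epsilon>) * real (k - i))"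

text \<open>A set of symbol deletions and insertions turning \<open>A\<close> into \<open>B\<close>: \<open>Del\<close> holds the positions
  in \<open>A\<close> of the deleted symbols, \<open>Ins\<close> the positions in \<open>B\<close> of the inserted ones; the remaining
  symbols of \<open>A\<close> become, in order, the remaining symbols of \<open>B\<close>.\<close>

definition edit_script :: "'a list \<Rightarrow> 'a list \<Rightarrow> nat set \<Rightarrow> nat set \<Rightarrow> bool" where
  "edit_script A B Del Ins \<longleftrightarrow>
     Del \<subseteq> {..<length A} \<and> Ins \<subseteq> {..<length B} \<and> nths A (- Del) = nths B (- Ins)"

section \<open>Model of computation\<close>

text \<open>Structured programs for a random access machine with unit-cost instructions.  A store
  consists of registers holding natural numbers and of growable arrays of natural numbers;
  a symbol of an alphabet is one machine word.  Multiplication and bit operations are left out,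
  because unit cost would be unrealistic for them on unbounded words.  \<open>Call P as bs\<close> runs \<open>P\<close>
  in a fresh store whose array \<open>i\<close> is a copy of the caller's array \<open>as ! i\<close>, and then copies
  array \<open>i\<close> of that store to the caller's array \<open>bs ! i\<close>; each copied word costs one unit.\<close>

datatype com =
    Const nat nat
  | Add nat nat nat
  | Sub nat nat nat
  | Length nat nat
  | Read nat nat nat
  | Write nat nat nat
  | Push nat nat
  | Clear nat
  | Seq com com
  | If nat com com
  | While nat com
  | Call com "nat list" "nat list"

type_synonym regs = "nat \<Rightarrow> nat"
type_synonym arrays = "nat \<Rightarrow> nat list"

definition init_arrays :: "nat list list \<Rightarrow> arrays" where
  "init_arrays xss a = (if a < length xss then xss ! a else [])"

definition return_arrays :: "nat list \<Rightarrow> arrays \<Rightarrow> arrays \<Rightarrow> arrays" where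
  "return_arrays bs Y X = fold (\<lambda>(i, b) Z. Z(b := Y i)) (enumerate 0 bs) X"

text \<open>\<open>exec c R X t R' X'\<close>: started with registers \<open>R\<close> and arrays \<open>X\<close>, the program \<open>c\<close> terminates
  after \<open>t\<close> time units with registers \<open>R'\<close> and arrays \<open>X'\<close>.  Subtraction is truncated, reading
  out of range yields 0, and writing out of range has no effect.\<close>

inductive exec :: "com \<Rightarrow> regs \<Rightarrow> arrays \<Rightarrow> nat \<Rightarrow> regs \<Rightarrow> arrays \<Rightarrow> bool" where
  Const: "exec (Const r c) R X 1 (R(r := c)) X"
| Add: "exec (Add r p q) R X 1 (R(r := R p + R q)) X"
| Sub: "exec (Sub r p q) R X 1 (R(r := R p - R q)) X"
| Length: "exec (Length r a) R X 1 (R(r := length (X a))) X"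
| Read: "exec (Read r a p) R X 1 (R(r := (if R p < length (X a) then X a ! R p else 0))) X"
| Write: "exec (Write a p q) R X 1 R (X(a := (X a)[R p := R q]))"
| Push: "exec (Push a q) R X 1 R (X(a := X a @ [R q]))"
| Clear: "exec (Clear a) R X 1 R (X(a := []))"
| Seq: "exec c1 R X t1 R1 X1 \<Longrightarrow> exec c2 R1 X1 t2 R2 X2 \<Longrightarrow>
    exec (Seq c1 c2) R X (t1 + t2) R2 X2"
| IfTrue: "R p \<noteq> 0 \<Longrightarrow> exec c1 R X t R' X' \<Longrightarrow> exec (If p c1 c2) R X (t + 1) R' X'"
| IfFalse: "R p = 0 \<Longrightarrow> exec c2 R X t R' X' \<Longrightarrow> exec (If p c1 c2) R X (t + 1) R' X'"
| WhileFalse: "R p = 0 \<Longrightarrow> exec (While p c) R X 1 R X"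
| WhileTrue: "R p \<noteq> 0 \<Longrightarrow> exec c R X t1 R1 X1 \<Longrightarrow> exec (While p c) R1 X1 t2 R2 X2 \<Longrightarrow>
    exec (While p c) R X (t1 + t2 + 1) R2 X2"
| Call: "exec c (\<lambda>_. 0) (init_arrays (map X as)) t R' Y \<Longrightarrow>
    exec (Call c as bs) R X
      (t + 1 + sum_list (map (\<lambda>a. length (X a)) as) + (\<Sum>i<length bs. length (Y i)))
      R (return_arrays bs Y X)"

inductive_cases exec_cases:
  "exec (Const r k) R X t R' X'" "exec (Add r p q) R X t R' X'" "exec (Sub r p q) R X t R' X'"
  "exec (Length r a) R X t R' X'" "exec (Read r a p) R X t R' X'" "exec (Write a p q) R X t R' X'"
  "exec (Push a q) R X t R' X'" "exec (Clear a) R X t R' X'"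

inductive_cases Seq_cases: "exec (Seq c1 c2) R X t R' X'"
inductive_cases If_cases: "exec (If p c1 c2) R X t R' X'"
inductive_cases While_cases: "exec (While p c) R X t R' X'"
inductive_cases Call_cases: "exec (Call c as bs) R X t R' X'"

lemma exec_deterministic:
  "exec c R X t R1 X1 \<Longrightarrow> exec c R X u R2 X2 \<Longrightarrow> u = t \<and> R2 = R1 \<and> X2 = X1"
proof (induction arbitrary: u R2 X2 rule: exec.induct)
  case (Seq c1 R X t1 R1 X1 c2 t2 R3 X3)
  from Seq.prems obtain u1 u2 Ra Xa
    where u: "u = u1 + u2" and 1: "exec c1 R X u1 Ra Xa" and 2: "exec c2 Ra Xa u2 R2 X2"
    by (rule Seq_cases) blast
  from Seq.IH(1)[OF 1] have "u1 = t1" "Ra = R1" "Xa = X1" by simp_all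
  with Seq.IH(2) 2 u show ?case by blast
next
  case (IfTrue R p c1 X t R' X' c2)
  from IfTrue.prems show ?case
    by (rule If_cases) (use IfTrue.hyps in \<open>auto dest: IfTrue.IH\<close>)
next
  case (IfFalse R p c2 X t R' X' c1)
  from IfFalse.prems show ?case
    by (rule If_cases) (use IfFalse.hyps in \<open>auto dest: IfFalse.IH\<close>)
next
  case (WhileFalse R p c X)
  from WhileFalse.prems show ?case
    by (rule While_cases) (use WhileFalse.hyps in simp_all)
next
  case (WhileTrue R p c X t1 R1 X1 t2 R3 X3)
  from WhileTrue.prems WhileTrue.hyps(1) obtain u1 u2 Ra Xa
    where u: "u = u1 + u2 + 1" and 1: "exec c R X u1 Ra Xa"
      and 2: "exec (While p c) Ra Xa u2 R2 X2"
    by (auto elim: While_cases)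
  from WhileTrue.IH(1)[OF 1] have "u1 = t1" "Ra = R1" "Xa = X1" by simp_all
  with WhileTrue.IH(2) 2 u show ?case by blast
next
  case (Call c X as t R' Y bs R)
  from Call.prems obtain t' Ra Ya
    where 1: "exec c (\<lambda>_. 0) (init_arrays (map X as)) t' Ra Ya"
      and u: "u = t' + 1 + sum_list (map (\<lambda>a. length (X a)) as) + (\<Sum>i<length bs. length (Ya i))"
        "R2 = R" "X2 = return_arrays bs Ya X"
    by (rule Call_cases) auto
  from Call.IH[OF 1] have "t' = t" "Ya = Y" by simp_all
  with u show ?case by simp
qed (erule exec_cases; simp)+

text \<open>The two programs of interest both take a pair of strings of two-component symbols; each
  string is passed as two arrays, one per component.\<close>

definition runs_on :: "com \<Rightarrow> (nat \<times> nat) list \<Rightarrow> (nat \<times> nat) list \<Rightarrow> nat \<Rightarrow> arrays \<Rightarrow> bool" where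
  "runs_on P S S' t Y \<longleftrightarrow>
     (\<exists>R. exec P (\<lambda>_. 0) (init_arrays [map fst S, map snd S, map fst S', map snd S']) t R Y)"

definition near_linear :: "(nat \<Rightarrow> real) \<Rightarrow> bool" where
  "near_linear f \<longleftrightarrow> (\<exists>p::nat. f \<in> O(\<lambda>n. real n * ln (real n) ^ p))"

section \<open>Indexing sequences\<close>

text \<open>\<open>I\<close> over the alphabet \<open>\<Sigma>I\<close> is an \<open>\<epsilon>\<close>-indexing sequence by virtue of the program \<open>A\<close>.  The
  program lists the deletions in array 0 and the insertions in array 1.  For inputs \<open>S''\<close> of
  length at most \<open>r * n\<close> its running time is at most \<open>\<tau> r n\<close>.  With every \<open>\<tau> r\<close> near-linear, this
  is the requirement of near-linear running time for \<open>S''\<close> of length \<open>O(n)\<close>: the hidden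
  constants depend on the constant \<open>r\<close> of that \<open>O(n)\<close>, but not on \<open>n\<close>, \<open>I\<close>, \<open>T\<close> or \<open>S''\<close>.\<close>

definition indexing_sequence ::
    "real \<Rightarrow> (real \<Rightarrow> nat \<Rightarrow> real) \<Rightarrow> nat set \<Rightarrow> nat list \<Rightarrow> com \<Rightarrow> bool" where
  "indexing_sequence \<epsilon> \<tau> \<Sigma>I I A \<longleftrightarrow>
     set I \<subseteq> \<Sigma>I \<and>
     (\<forall>T S'' r. length T = length I \<and> set S'' \<subseteq> UNIV \<times> \<Sigma>I \<and>
          real (length S'') \<le> r * real (length I) \<longrightarrow>
        (\<exists>t Y. runs_on A (zip T I) S'' t Y \<and>
           real t \<le> \<tau> r (length I) \<and>
           distinct (Y 0) \<and> distinct (Y 1) \<and>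
           edit_script (zip T I) S'' (set (Y 0)) (set (Y 1)) \<and>
           real (length (Y 0) + length (Y 1)) \<le> (1 + \<epsilon>) * real (ED (zip T I) S'')))"

section \<open>Channels and decodings\<close>

text \<open>Behaviour of the channel: \<open>Del\<close> are the positions in \<open>S\<close> of the deleted symbols, \<open>Ins\<close> the
  positions in \<open>S'\<close> of the inserted ones.\<close>

definition channel :: "real \<Rightarrow> real \<Rightarrow> 'a list \<Rightarrow> 'a list \<Rightarrow> nat set \<Rightarrow> nat set \<Rightarrow> bool" where
  "channel \<delta> \<gamma> S S' Del Ins \<longleftrightarrow>
     edit_script S S' Del Ins \<and>
     real (card Del) \<le> \<delta> * real (length S) \<and> real (card Ins) \<le> \<gamma> * real (length S)"

text \<open>The undeleted symbol \<open>S ! i\<close> arrives as the symbol at position \<open>j\<close> iff equally many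
  undeleted symbols precede it as there are non-inserted symbols before \<open>j\<close>.\<close>

definition arrives :: "nat set \<Rightarrow> nat set \<Rightarrow> nat \<Rightarrow> nat \<Rightarrow> bool" where
  "arrives Del Ins i j \<longleftrightarrow>
     i \<notin> Del \<and> j \<notin> Ins \<and> card ({..<i} - Del) = card ({..<j} - Ins)"

definition misdecodings :: "nat \<Rightarrow> nat set \<Rightarrow> nat set \<Rightarrow> nat option list \<Rightarrow> nat set" where
  "misdecodings n Del Ins dec =
     {i. i < n \<and> (\<exists>j < length dec. arrives Del Ins i j \<and> dec ! j \<noteq> Some i)}"

text \<open>A decoder leaves its answer in array 0, with 0 for \<open>\<bottom>\<close> (here \<open>None\<close>) and \<open>i + 1\<close> for
  position \<open>i\<close>.\<close>

primrec decoded :: "nat \<Rightarrow> nat option" where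
  "decoded 0 = None"
| "decoded (Suc i) = Some i"

definition decodes_to ::
    "com \<Rightarrow> (nat \<times> nat) list \<Rightarrow> (nat \<times> nat) list \<Rightarrow> nat \<Rightarrow> nat option list \<Rightarrow> bool" where
  "decodes_to D S S' t dec \<longleftrightarrow>
     (\<exists>Y. runs_on D S S' t Y \<and> dec = map decoded (Y 0)) \<and>
     length dec = length S' \<and> set dec \<subseteq> insert None (Some ` {..<length S})"

end

theory Submission
  imports Defs "HOL-Library.Sublist"
begin

text \<open>The decoder works in \<open>K\<close> rounds.  Each round runs the program of the indexing sequence on \<open>S\<close> and
  the symbols of \<open>S'\<close> that are still undecoded, and decodes every symbol that the resulting edit
  script matches; a round decodes at most one symbol to each position.

  If \<open>U\<close> arrived symbols remain undecoded after all rounds, they are common to \<open>S\<close> and to the \<open>L\<close>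
  symbols remaining in any round, so that the edit distance there is at most \<open>n + L - 2 U\<close> and the
  round matches at least \<open>(1 + \<epsilon>I) U - \<epsilon>I (n + L) / 2\<close> symbols.  All rounds together match at
  most \<open>(1 + \<gamma>) n\<close> symbols, which bounds \<open>U\<close>.  The wrongly decoded symbols of one round give a
  monotone matching of the synchronization string with itself without fixed points, and such a
  matching has at most \<open>\<epsilon>s n\<close> pairs.\<close>


section \<open>Edit distance and self-matchings of synchronization strings\<close>

lemma edit_step_Cons: "edit_step xs ys \<Longrightarrow> edit_step (a # xs) (a # ys)"
  by (induction rule: edit_step.induct) (metis append_Cons edit_step.intros)+

lemma edit_steps_Cons: "(edit_step ^^ k) xs ys \<Longrightarrow> (edit_step ^^ k) (a # xs) (a # ys)"
  by (induction k arbitrary: ys) (auto intro: edit_step_Cons relcomppI)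

text \<open>Each symbol of \<open>ys\<close> outside \<open>xs\<close> costs one deletion in one
  direction and one insertion in the other. The number of steps is exact, because \<open>ED\<close>
  minimises over exact powers of \<open>edit_step\<close>.\<close>

lemma edit_steps_subseq:
  "subseq xs ys \<Longrightarrow> (edit_step ^^ (length ys - length xs)) ys xs \<and>
     (edit_step ^^ (length ys - length xs)) xs ys"
proof (induction rule: list_emb.induct)
  case (list_emb_Nil ys)
  show ?case
  proof (induction ys)
    case (Cons y ys)
    have "edit_step (y # ys) ys" "edit_step ys (y # ys)"
      using edit_step.intros[of "[]"] by simp_all
    from relpowp_Suc_I2[of edit_step, OF this(1)] relpowp_Suc_I[of _ edit_step, OF _ this(2)] Cons
    show ?case by simp
  qed simp
next
  case (list_emb_Cons xs ys y)
  have "edit_step (y # ys) ys" "edit_step ys (y # ys)"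
    using edit_step.intros[of "[]"] by simp_all
  moreover have "length (y # ys) - length xs = Suc (length ys - length xs)"
    using list_emb_length[OF list_emb_Cons.hyps] by simp
  ultimately show ?case
    using list_emb_Cons.IH relpowp_Suc_I[of _ edit_step] relpowp_Suc_I2[of edit_step]
    by (auto simp del: relpowp.simps)
next
  case (list_emb_Cons2 x y xs ys)
  then show ?case by (simp add: edit_steps_Cons)
qed

text \<open>Delete from \<open>A\<close> all that lies outside \<open>C\<close>, then insert the
  rest of \<open>B\<close>. The additive form avoids truncated subtraction.\<close>

lemma ED_le_common_subseq:
  assumes "subseq C A" "subseq C B"
  shows "ED A B + 2 * length C \<le> length A + length B"
proof -
  have "(edit_step ^^ ((length A - length C) + (length B - length C))) A B"
    unfolding relpowp_add using edit_steps_subseq[OF assms(1)] edit_steps_subseq[OF assms(2)] by blast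
  then have "ED A B \<le> (length A - length C) + (length B - length C)"
    unfolding ED_def by (rule Least_le)
  with list_emb_length[OF assms(1)] list_emb_length[OF assms(2)] show ?thesis by simp
qed

lemma subseq_map_nth:
  assumes "sorted_wrt (<) is" "set is \<subseteq> {..<length xs}"
  shows "subseq (map ((!) xs) is) xs"
proof -
  have "subseq is [0..<length xs]"
    using assms by (intro sorted_subset_imp_subseq) auto
  from subseq_map[OF this, of "(!) xs"] show ?thesis by (simp add: map_nth)
qed

lemma subseq_substring:
  assumes "sorted_wrt (<) is" "set is \<subseteq> {i..<j}" "j \<le> length xs"
  shows "subseq (map ((!) xs) is) (substring xs i j)"
proof -
  have "subseq is [i..<j]"
    using assms by (intro sorted_subset_imp_subseq) auto
  moreover have "map ((!) xs) [i..<j] = substring xs i j"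
    using assms(3) by (auto simp: substring_def intro: nth_equalityI)
  ultimately show ?thesis using subseq_map by metis
qed

section \<open>Monotone self-matchings without fixed points\<close>

definition strict_chain :: "(nat \<times> nat) list \<Rightarrow> bool" where
  "strict_chain = sorted_wrt (\<lambda>p q. fst p < fst q \<and> snd p < snd q)"

text \<open>The matched symbols are a common subsequence of two adjacent substrings, so a long
  matching would push their edit distance below the synchronization bound.\<close>

lemma sync_string_adjacent_matching:
  assumes sync: "sync_string \<epsilon> T"
    and M: "sorted_wrt (<) is" "sorted_wrt (<) js" "map ((!) T) is = map ((!) T) js"
    and bounds: "set is \<subseteq> {i..<j}" "set js \<subseteq> {j..<k}" "i < j" "j < k" "k \<le> length T"
  shows "2 * real (length is) \<le> \<epsilon> * (real k - real i)"
proof -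
  have "subseq (map ((!) T) is) (substring T i j)" "subseq (map ((!) T) is) (substring T j k)"
    using subseq_substring[OF M(1), of i j T] subseq_substring[OF M(2), of j k T] M(3) bounds by auto
  from ED_le_common_subseq[OF this] bounds
  have "ED (substring T i j) (substring T j k) + 2 * length is \<le> k - i"
    by (simp add: substring_def)
  moreover have "real (ED (substring T i j) (substring T j k)) > (1 - \<epsilon>) * real (k - i)"
    using sync bounds unfolding sync_string_def by blast
  ultimately show ?thesis using bounds(3,4) by (simp add: of_nat_diff algebra_simps)
qed

text \<open>The pairs starting before the larger coordinate of the first pair match two adjacent
  substrings.  The left substrings arising in this way are disjoint, and so are the right ones, so
  that the total length of the substrings is at most \<open>2 * length T\<close>.\<close>

lemma sync_string_self_matching_aux:
  assumes sync: "sync_string \<epsilon> T" and "0 \<le> \<epsilon>"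
  shows "strict_chain M \<Longrightarrow> (\<And>a b. (a, b) \<in> set M \<Longrightarrow>
      p \<le> a \<and> p \<le> b \<and> q \<le> max a b \<and> a < length T \<and> b < length T \<and> a \<noteq> b \<and> T ! a = T ! b) \<Longrightarrow>
    p \<le> length T \<Longrightarrow> q \<le> length T \<Longrightarrow>
    2 * real (length M) \<le> \<epsilon> * ((real (length T) - real p) + (real (length T) - real q))"
proof (induction M arbitrary: p q rule: length_induct)
  case (1 M)
  show ?case
  proof (cases M)
    case Nil
    then show ?thesis using 1(4,5) \<open>0 \<le> \<epsilon>\<close> by simp
  next
    case (Cons ab M')
    obtain a b where ab: "ab = (a, b)" by force
    \<comment> \<open>The chain is cut where both coordinates have reached \<open>c\<close>. The
      initial group matches the substrings from \<open>min a b\<close> to \<open>c\<close> and from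
      \<open>c\<close> to \<open>k\<close>; the rest is treated by induction, with \<open>p\<close>
      replaced by \<open>c\<close> and \<open>q\<close> by \<open>k\<close>.\<close>
    define c where "c = max a b"
    define small where "small = (\<lambda>p::nat \<times> nat. min (fst p) (snd p) < c)"
    let ?G = "takeWhile small M" and ?N = "dropWhile small M"
    have M0: "(a, b) \<in> set M" using Cons ab by simp
    have ab_ne: "a \<noteq> b" using 1(3)[OF M0] by blast
    have "small (a, b)" using ab_ne by (auto simp: small_def c_def)
    then have G0: "?G = (a, b) # takeWhile small M'" using Cons ab by simp
    have "strict_chain (?G @ ?N)" using 1(2) by simp
    then have chainG: "strict_chain ?G" and chainN: "strict_chain ?N"
      and GN: "\<And>x y. x \<in> set ?G \<Longrightarrow> y \<in> set ?N \<Longrightarrow> fst x < fst y \<and> snd x < snd y"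
      unfolding strict_chain_def sorted_wrt_append by auto
    define l where "l = last ?G"
    \<comment> \<open>The last pair of the group dominates it in both coordinates; the successor
      makes \<open>k\<close> an exclusive right end.\<close>
    define k where "k = Suc (max (fst l) (snd l))"
    have l: "l \<in> set ?G" using G0 by (simp add: l_def)
    have lM: "l \<in> set M" using l set_takeWhileD by metis
    have G_ge: "a \<le> fst x \<and> b \<le> snd x" if "x \<in> set ?G" for x
      using that chainG G0 unfolding strict_chain_def by auto
    have G_le: "fst x \<le> fst l \<and> snd x \<le> snd l" if "x \<in> set ?G" for x
    proof -
      obtain ys where split: "?G = ys @ [l]"
        using G0 unfolding l_def by (metis append_butlast_last_id list.distinct(1))
      from that consider "x \<in> set ys" | "x = l" unfolding split by auto
      then show ?thesis
        using chainG unfolding split strict_chain_def sorted_wrt_append by cases auto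
    qed
    have kT: "k \<le> length T" using 1(3)[of "fst l" "snd l"] lM by (simp add: k_def Suc_le_eq)
    have ck: "c < k" using G_ge[OF l] by (auto simp: k_def c_def)
    have fsts: "sorted_wrt (<) (map fst ?G)" and snds: "sorted_wrt (<) (map snd ?G)"
      using chainG unfolding strict_chain_def sorted_wrt_map
      by (auto elim: sorted_wrt_mono_rel[rotated])
    have eqs: "map ((!) T) (map fst ?G) = map ((!) T) (map snd ?G)"
    proof -
      have "T ! fst x = T ! snd x" if "x \<in> set ?G" for x
        using 1(3)[of "fst x" "snd x"] set_takeWhileD[OF that] by simp
      then show ?thesis by simp
    qed
    have group: "2 * real (length ?G) \<le> \<epsilon> * (real k - real (min a b))"
    proof (cases "a < b")
      case True
      have *: "fst x < b" if x: "x \<in> set ?G" for x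
        using set_takeWhileD[OF x] G_ge[OF x] True by (auto simp: small_def c_def)
      have "set (map fst ?G) \<subseteq> {a..<b}" using G_ge * by fastforce
      moreover have "set (map snd ?G) \<subseteq> {b..<k}"
        using G_ge G_le by (fastforce simp: k_def)
      ultimately show ?thesis
        using sync_string_adjacent_matching[OF sync fsts snds eqs, of a b k] True ck kT
        by (simp add: c_def)
    next
      case False
      then have "b < a" using ab_ne by simp
      have *: "snd x < a" if x: "x \<in> set ?G" for x
        using set_takeWhileD[OF x] G_ge[OF x] False by (auto simp: small_def c_def)
      have "set (map snd ?G) \<subseteq> {b..<a}" using G_ge * by fastforce
      moreover have "set (map fst ?G) \<subseteq> {a..<k}"
        using G_ge G_le by (fastforce simp: k_def)
      ultimately show ?thesis
        using sync_string_adjacent_matching[OF sync snds fsts eqs[symmetric], of b a k] \<open>b < a\<close> ck kT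
        by (simp add: c_def)
    qed
    have Nc: "c \<le> min x y" if xy: "(x, y) \<in> set ?N" for x y
    proof -
      obtain h N' where N: "?N = h # N'" using xy by (cases ?N) auto
      \<comment> \<open>The first pair of the rest fails \<open>small\<close>, and both coordinates
        only grow from there.\<close>
      have "\<not> small h" using hd_dropWhile[of small M] N by auto
      then have "c \<le> min (fst h) (snd h)" unfolding small_def by linarith
      moreover have "fst h \<le> x \<and> snd h \<le> y" using xy chainN unfolding N strict_chain_def by auto
      ultimately show ?thesis by auto
    qed
    have "length ?N < length M" using Cons ab G0
      by (metis length_dropWhile_le le_imp_less_Suc length_Cons dropWhile.simps(2) \<open>small (a, b)\<close>)
    moreover have "c \<le> x \<and> c \<le> y \<and> k \<le> max x y \<and> x < length T \<and> y < length T \<and> x \<noteq> y \<and> T ! x = T ! y"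
      if "(x, y) \<in> set ?N" for x y
      using Nc[OF that] GN[OF l that] 1(3)[of x y] set_dropWhileD[OF that] by (auto simp: k_def)
    ultimately have "2 * real (length ?N) \<le> \<epsilon> * ((real (length T) - real c) + (real (length T) - real k))"
      using 1(1)[rule_format, OF _ chainN, of c k] kT ck by simp
    moreover have "length M = length ?G + length ?N"
      by (metis length_append takeWhile_dropWhile_id)
    ultimately have "2 * real (length M) \<le>
        \<epsilon> * (real k - real (min a b)) + \<epsilon> * ((real (length T) - real c) + (real (length T) - real k))"
      using group by simp
    \<comment> \<open>The terms with \<open>k\<close> cancel; what remains has the form of the
      claim, with \<open>min a b\<close> and \<open>c\<close> in place of \<open>p\<close> and
      \<open>q\<close>.\<close>
    also have "\<dots> = \<epsilon> * ((real (length T) - real (min a b)) + (real (length T) - real c))"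
      by (simp add: algebra_simps)
    also have "\<dots> \<le> \<epsilon> * ((real (length T) - real p) + (real (length T) - real q))"
      using 1(3)[OF M0] \<open>0 \<le> \<epsilon>\<close> by (intro mult_left_mono add_mono) (auto simp: c_def)
    finally show ?thesis .
  qed
qed

lemma sync_string_self_matching:
  assumes "sync_string \<epsilon> T" "0 \<le> \<epsilon>" "strict_chain M"
    and "\<And>a b. (a, b) \<in> set M \<Longrightarrow> a < length T \<and> b < length T \<and> a \<noteq> b \<and> T ! a = T ! b"
  shows "real (length M) \<le> \<epsilon> * real (length T)"
  using sync_string_self_matching_aux[OF assms(1-3), of 0 0] assms(4) by (simp add: algebra_simps)

section \<open>Arrival of symbols\<close>

lemma nths_cong: "(\<And>i. i < length xs \<Longrightarrow> i \<in> A \<longleftrightarrow> i \<in> B) \<Longrightarrow> nths xs A = nths xs B"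
  unfolding nths_def by (rule arg_cong[where f = "map fst"], rule filter_cong) (auto dest: set_zip_rightD)

lemma length_nths_le: "length (nths xs A) \<le> length xs"
  unfolding nths_def length_map by (rule order.trans[OF length_filter_le]) simp

text \<open>The smaller of the two points is itself counted below the larger one.\<close>

lemma card_below_less_iff:
  fixes i i' :: nat
  assumes "i \<notin> A" "i' \<notin> A"
  shows "card ({..<i} - A) < card ({..<i'} - A) \<longleftrightarrow> i < i'"
proof -
  have mono: "card ({..<a} - A) < card ({..<b} - A)" if "a < b" "a \<notin> A" for a b :: nat
    using that by (intro psubset_card_mono) auto
  show ?thesis using mono[of i i'] mono[of i' i] assms by (cases i i' rule: linorder_cases) auto
qed

text \<open>Arrival equates ranks on the two sides, and ranks reflect the order of positions. Hence
  arrival is a monotone partial bijection.\<close>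

lemma arrives_less_iff:
  "arrives Del Ins i j \<Longrightarrow> arrives Del Ins i' j' \<Longrightarrow> i < i' \<longleftrightarrow> j < j'"
  unfolding arrives_def by (metis card_below_less_iff)

lemma arrives_unique:
  "arrives Del Ins i j \<Longrightarrow> arrives Del Ins i' j \<Longrightarrow> i' = i"
  by (metis arrives_less_iff linorder_neq_iff)

text \<open>Splitting \<open>xs\<close> just before \<open>i\<close>, the selected part of the
  prefix has exactly this rank as its length.\<close>

lemma nth_nths_rank:
  assumes "i < length xs" "i \<in> A"
  shows "nths xs A ! card ({..<i} \<inter> A) = xs ! i"
proof -
  have "length (nths (take i xs) A) = card ({..<i} \<inter> A)"
    using assms(1) by (simp add: length_nths) (rule arg_cong[where f = card], auto)
  moreover have "nths (take i xs @ xs ! i # drop (Suc i) xs) A =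
      nths (take i xs) A @ nths (xs ! i # drop (Suc i) xs) {j. j + i \<in> A}"
    using assms(1) by (simp add: nths_append)
  ultimately show ?thesis
    using assms by (simp add: nths_Cons nth_append flip: id_take_nth_drop)
qed

text \<open>Both symbols occupy the same rank in the common string of surviving symbols.\<close>

lemma edit_script_arrives:
  assumes "edit_script S S' Del Ins" "arrives Del Ins i j" "i < length S" "j < length S'"
  shows "S ! i = S' ! j"
proof -
  have "S ! i = nths S (- Del) ! card ({..<i} - Del)"
    using nth_nths_rank[of i S "- Del"] assms by (simp add: arrives_def Diff_eq)
  also have "\<dots> = nths S' (- Ins) ! card ({..<j} - Ins)"
    using assms by (simp add: arrives_def edit_script_def)
  also have "\<dots> = S' ! j"
    using nth_nths_rank[of j S' "- Ins"] assms by (simp add: arrives_def Diff_eq)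
  finally show ?thesis .
qed

lemma length_nths_Compl:
  assumes "A \<subseteq> {..<length xs}"
  shows "length (nths xs (- A)) + card A = length xs"
proof -
  have "length (nths xs (- A)) = card ({..<length xs} - A)"
    by (simp add: length_nths) (rule arg_cong[where f = card], auto)
  moreover have "card A \<le> length xs" using card_mono[OF _ assms] by simp
  ultimately show ?thesis using card_Diff_subset[of A "{..<length xs}"] assms finite_subset[OF assms]
    by simp
qed

text \<open>A received symbol is either inserted or one of the at most \<open>length S\<close>
  survivors.\<close>

lemma channel_length:
  assumes "channel \<delta> \<gamma> S S' Del Ins"
  shows "real (length S') \<le> (1 + \<gamma>) * real (length S)"
proof -
  have "length (nths S (- Del)) + card Del = length S" "length (nths S' (- Ins)) + card Ins = length S'"
    by (rule length_nths_Compl, use assms in \<open>simp add: channel_def edit_script_def\<close>)+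
  then have "length S' \<le> length S + card Ins"
    using assms by (simp add: channel_def edit_script_def)
  then have "real (length S') \<le> real (length S) + real (card Ins)" by linarith
  also have "\<dots> \<le> real (length S) + \<gamma> * real (length S)"
    using assms by (simp add: channel_def)
  finally show ?thesis by (simp add: algebra_simps)
qed

section \<open>Running time of programs\<close>

text \<open>Inversion and introduction are combined into equations, so that the simplifier can
  execute straight-line code symbolically.\<close>

lemma exec_simps:
  "exec (Const r k) R X t R' X' \<longleftrightarrow> t = 1 \<and> R' = R(r := k) \<and> X' = X"
  "exec (Add r p q) R X t R' X' \<longleftrightarrow> t = 1 \<and> R' = R(r := R p + R q) \<and> X' = X"
  "exec (Sub r p q) R X t R' X' \<longleftrightarrow> t = 1 \<and> R' = R(r := R p - R q) \<and> X' = X"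
  "exec (Length r a) R X t R' X' \<longleftrightarrow> t = 1 \<and> R' = R(r := length (X a)) \<and> X' = X"
  "exec (Read r a p) R X t R' X' \<longleftrightarrow>
     t = 1 \<and> R' = R(r := (if R p < length (X a) then X a ! R p else 0)) \<and> X' = X"
  "exec (Write a p q) R X t R' X' \<longleftrightarrow> t = 1 \<and> R' = R \<and> X' = X(a := (X a)[R p := R q])"
  "exec (Push a q) R X t R' X' \<longleftrightarrow> t = 1 \<and> R' = R \<and> X' = X(a := X a @ [R q])"
  by (auto elim: exec_cases intro: exec.intros(1-8)[unfolded One_nat_def] split del: if_split)

lemma exec_Seq: "exec (Seq c1 c2) R X t R' X' \<longleftrightarrow>
  (\<exists>t1 R1 X1 t2. exec c1 R X t1 R1 X1 \<and> exec c2 R1 X1 t2 R' X' \<and> t = t1 + t2)"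
  by (auto elim!: Seq_cases intro: exec.Seq)

lemma exec_If: "exec (If p c1 c2) R X t R' X' \<longleftrightarrow>
  (\<exists>t'. exec (if R p \<noteq> 0 then c1 else c2) R X t' R' X' \<and> t = t' + 1)"
  by (auto elim!: If_cases intro: exec.IfTrue[simplified] exec.IfFalse[simplified])

text \<open>The invariant is indexed by the number of completed iterations and determines register
  \<open>p\<close>, so the loop stops exactly at index \<open>N\<close>. Each iteration costs one
  unit for the test besides the body, and the final test costs one more.\<close>

lemma exec_counting_loop:
  assumes step: "\<And>k R X. k < N \<Longrightarrow> Inv k R X \<Longrightarrow>
      \<exists>t R' X'. exec c R X t R' X' \<and> t \<le> b \<and> Inv (Suc k) R' X'"
    and counter: "\<And>k R X. Inv k R X \<Longrightarrow> R p = N - k"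
    and init: "Inv 0 R X"
  shows "\<exists>t R' X'. exec (While p c) R X t R' X' \<and> t \<le> N * (b + 1) + 1 \<and> Inv N R' X'"
proof -
  have "\<exists>t R' X'. exec (While p c) R X t R' X' \<and> t \<le> (N - k) * (b + 1) + 1 \<and> Inv N R' X'"
    if "Inv k R X" "k \<le> N" for k R X
    using that
  proof (induction "N - k" arbitrary: k R X)
    case 0
    then show ?case
      using counter[of k R X] by (metis WhileFalse diff_is_0_eq' diff_zero le_add2 le_antisym diff_is_0_eq)
  next
    case (Suc l)
    then have "k < N" by simp
    from step[OF this Suc.prems(1)] obtain t1 R1 X1
      where 1: "exec c R X t1 R1 X1" "t1 \<le> b" "Inv (Suc k) R1 X1" by blast
    have "l = N - Suc k" "Suc k \<le> N" using \<open>k < N\<close> Suc.hyps(2) by simp_all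
    from Suc.hyps(1)[OF this(1) 1(3) this(2)] obtain t2 R2 X2
      where 2: "exec (While p c) R1 X1 t2 R2 X2" "t2 \<le> (N - Suc k) * (b + 1) + 1" "Inv N R2 X2"
      by blast
    have "R p \<noteq> 0" using counter[OF Suc.prems(1)] \<open>k < N\<close> by simp
    with 1(1) 2(1) have "exec (While p c) R X (t1 + t2 + 1) R2 X2" by (intro WhileTrue)
    moreover have "N - k = Suc (N - Suc k)" using \<open>k < N\<close> by simp
    then have "t1 + t2 + 1 \<le> (N - k) * (b + 1) + 1" using 1(2) 2(2) by simp
    ultimately show ?case using 2(3) by blast
  qed
  from this[OF init] show ?thesis by simp
qed

text \<open>Only the leading arrays are prescribed: the others may hold scratch data, which a
  \<open>Call\<close> does not copy back.\<close>

definition computes :: "com \<Rightarrow> nat list list \<Rightarrow> nat list list \<Rightarrow> nat \<Rightarrow> bool" where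
  "computes P xss yss t \<longleftrightarrow> (\<exists>t' R Y. exec P (\<lambda>_. 0) (init_arrays xss) t' R Y \<and> t' \<le> t \<and>
     (\<forall>i<length yss. Y i = yss ! i))"

text \<open>A counterpart of \<open>return_arrays\<close> that takes the returned lists explicitly
  and unfolds by simplification.\<close>

fun store :: "nat list \<Rightarrow> nat list list \<Rightarrow> arrays \<Rightarrow> arrays" where
  "store (b # bs) (ys # yss) X = store bs yss (X(b := ys))"
| "store _ _ X = X"

lemma fold_enumerate_store:
  "(\<And>i. i < length yss \<Longrightarrow> Y (k + i) = yss ! i) \<Longrightarrow> length bs = length yss \<Longrightarrow>
   fold (\<lambda>(i, b) Z. Z(b := Y i)) (enumerate k bs) X = store bs yss X"
proof (induction bs yss X arbitrary: k rule: store.induct)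
  case (1 b bs ys yss X)
  have "Y k = ys" using 1(2)[of 0] by simp
  moreover have "Y (Suc k + i) = yss ! i" if "i < length yss" for i
    using 1(2)[of "Suc i"] that by simp
  ultimately show ?case using 1(1)[of "Suc k"] 1(3) by (simp del: fun_upd_apply)
qed simp_all

text \<open>Quantifying over \<open>R\<close> makes the notion compositional for sequences of procedure calls, which
  neither read nor change the registers of the caller.\<close>

definition transforms :: "com \<Rightarrow> arrays \<Rightarrow> arrays \<Rightarrow> nat \<Rightarrow> bool" where
  "transforms c X X' t \<longleftrightarrow> (\<forall>R. \<exists>t'\<le>t. exec c R X t' R X')"

lemma transforms_Call:
  assumes "computes P (map X as) yss t" "length bs = length yss"
  shows "transforms (Call P as bs) X (store bs yss X)
    (t + 1 + sum_list (map length (map X as)) + sum_list (map length yss))"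
proof -
  from assms(1) obtain t' R' Y where Y: "exec P (\<lambda>_. 0) (init_arrays (map X as)) t' R' Y" "t' \<le> t"
    "\<forall>i<length yss. Y i = yss ! i" by (auto simp: computes_def)
  have "return_arrays bs Y X = store bs yss X"
    unfolding return_arrays_def using Y(3) assms(2) by (intro fold_enumerate_store) auto
  moreover have "(\<Sum>i<length bs. length (Y i)) = sum_list (map length yss)"
    using Y(3) assms(2) by (simp add: sum_list_sum_nth atLeast0LessThan)
  ultimately have "exec (Call P as bs) R X
      (t' + 1 + sum_list (map length (map X as)) + sum_list (map length yss)) R (store bs yss X)" for R
    using exec.Call[OF Y(1), where R = R and bs = bs] by (simp add: comp_def)
  with Y(2) show ?thesis by (auto simp: transforms_def intro!: exI[of _
      "t' + 1 + sum_list (map length (map X as)) + sum_list (map length yss)"])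
qed

lemma transforms_Seq:
  "transforms c1 X X1 t1 \<Longrightarrow> transforms c2 X1 X2 t2 \<Longrightarrow> transforms (Seq c1 c2) X X2 (t1 + t2)"
  unfolding transforms_def by (meson add_mono exec.Seq)

lemma transforms_mono: "transforms c X X' t \<Longrightarrow> t \<le> t' \<Longrightarrow> transforms c X X' t'"
  unfolding transforms_def by (meson order_trans)

lemma transforms_Call_le:
  assumes "computes P (map X as) yss t" "length bs = length yss"
    and "t + 1 + sum_list (map length (map X as)) + sum_list (map length yss) \<le> t'"
  shows "transforms (Call P as bs) X (store bs yss X) t'"
  using transforms_mono[OF transforms_Call[OF assms(1,2)] assms(3)] .

lemma computes_transforms:
  assumes "transforms c (init_arrays xss) X t" and "\<forall>i<length yss. X i = yss ! i"
  shows "computes c xss yss t"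
  using assms unfolding transforms_def computes_def by blast

section \<open>Linear-time array procedures\<close>

definition iota_zeros :: com where
  "iota_zeros = Seq (Length 0 0) (Seq (Const 2 1) (While 0
     (Seq (Push 1 1) (Seq (Push 2 3) (Seq (Add 1 1 2) (Sub 0 0 2))))))"

lemma computes_iota_zeros:
  "computes iota_zeros [xs] [xs, [0..<length xs], replicate (length xs) 0] (5 * length xs + 3)"
proof -
  \<comment> \<open>Register 0 counts down and register 1 up; register 2 holds the constant 1, and
    the untouched register 3 supplies the zeros.\<close>
  let ?Inv = "\<lambda>k R X. R 0 = length xs - k \<and> R 1 = k \<and> R 2 = 1 \<and> R 3 = 0 \<and>
    X 0 = xs \<and> X 1 = [0..<k] \<and> X 2 = replicate k (0::nat)"
  let ?R = "(\<lambda>_. 0)(0 := length xs, 2 := 1::nat)"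
  have "\<exists>t R' X'. exec (While 0 (Seq (Push 1 1) (Seq (Push 2 3) (Seq (Add 1 1 2) (Sub 0 0 2)))))
      ?R (init_arrays [xs]) t R' X' \<and> t \<le> length xs * (4 + 1) + 1 \<and> ?Inv (length xs) R' X'"
    by (rule exec_counting_loop)
      (auto simp: exec_simps exec_Seq init_arrays_def replicate_append_same)
  then show ?thesis
    unfolding computes_def iota_zeros_def
    by (force simp: exec_simps exec_Seq init_arrays_def less_Suc_eq numeral_eq_Suc)
qed

text \<open>A zero flag means that the symbol is kept. Writing the scratch register 6 stands for
  doing nothing.\<close>

definition select :: com where
  "select = Seq (Length 0 1) (Seq (Const 2 1) (While 0
     (Seq (Read 4 0 1) (Seq (Read 5 1 1) (Seq (If 4 (Const 6 0) (Push 2 5))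
       (Seq (Add 1 1 2) (Sub 0 0 2)))))))"

lemma nths_take_Suc:
  "k < length xs \<Longrightarrow> nths (take (Suc k) xs) A = nths (take k xs) A @ (if k \<in> A then [xs ! k] else [])"
  by (simp add: take_Suc_conv_app_nth nths_append)

lemma computes_select:
  assumes "length F = length xs"
  shows "computes select [F, xs] [F, xs, nths xs {j. F ! j = 0}] (7 * length xs + 3)"
proof -
  let ?Inv = "\<lambda>k R X. R 0 = length xs - k \<and> R 1 = k \<and> R 2 = 1 \<and>
    X 0 = F \<and> X 1 = xs \<and> X 2 = nths (take k xs) {j. F ! j = 0}"
  let ?R = "(\<lambda>_. 0)(0 := length xs, 2 := 1::nat)"
  have "\<exists>t R' X'. exec (While 0 (Seq (Read 4 0 1) (Seq (Read 5 1 1) (Seq (If 4 (Const 6 0) (Push 2 5))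
       (Seq (Add 1 1 2) (Sub 0 0 2))))))
      ?R (init_arrays [F, xs]) t R' X' \<and> t \<le> length xs * (6 + 1) + 1 \<and> ?Inv (length xs) R' X'"
    by (rule exec_counting_loop)
      (auto simp: exec_simps exec_Seq exec_If init_arrays_def nths_take_Suc assms)
  then show ?thesis
    unfolding computes_def select_def
    by (force simp: exec_simps exec_Seq init_arrays_def less_Suc_eq numeral_eq_Suc)
qed

text \<open>The successor matches the encoding of answers, in which 0 stands for an undecoded
  symbol.\<close>

definition assign_successors :: "nat list \<Rightarrow> nat list \<Rightarrow> nat list \<Rightarrow> nat list" where
  "assign_successors ys gs hs = fold (\<lambda>(g, h) ys. ys[h := Suc g]) (zip gs hs) ys"

lemma length_assign_successors [simp]: "length (assign_successors ys gs hs) = length ys"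
proof -
  have "length (fold (\<lambda>(g, h) ys. ys[h := Suc g]) zs ys) = length ys" for zs
    by (induction zs arbitrary: ys) auto
  then show ?thesis by (simp add: assign_successors_def)
qed

lemma assign_successors_take_Suc:
  assumes "k < length hs" "length gs = length hs"
  shows "assign_successors ys (take (Suc k) gs) (take (Suc k) hs) =
    (assign_successors ys (take k gs) (take k hs))[hs ! k := Suc (gs ! k)]"
  using assms by (simp add: assign_successors_def take_Suc_conv_app_nth)

lemma nth_assign_successors_other:
  assumes "length gs = length hs" "j \<notin> set hs"
  shows "assign_successors ys gs hs ! j = ys ! j"
proof -
  have "assign_successors ys (take k gs) (take k hs) ! j = ys ! j" if "k \<le> length hs" for k
    using that
  proof (induction k)
    case 0
    then show ?case by (simp add: assign_successors_def)
  next
    case (Suc k)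
    then have "hs ! k \<noteq> j" using assms(2) by auto
    with Suc assms(1) show ?case by (simp add: assign_successors_take_Suc)
  qed
  from this[of "length hs"] assms(1) show ?thesis by simp
qed

text \<open>Since \<open>hs\<close> is distinct, no later write overwrites the entry.\<close>

lemma nth_assign_successors:
  assumes "length gs = length hs" "distinct hs" "set hs \<subseteq> {..<length ys}" "c < length hs"
  shows "assign_successors ys gs hs ! (hs ! c) = Suc (gs ! c)"
proof -
  have "assign_successors ys (take k gs) (take k hs) ! (hs ! c) = Suc (gs ! c)"
    if "c < k" "k \<le> length hs" for k
    using that
  proof (induction k)
    case (Suc k)
    have *: "hs ! c < length ys" using assms(3) nth_mem[OF assms(4)] by auto
    show ?case
    proof (cases "c = k")
      case True
      with Suc assms(1) * show ?thesis by (simp add: assign_successors_take_Suc)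
    next
      case False
      with Suc.prems assms(2) have "hs ! k \<noteq> hs ! c" by (simp add: nth_eq_iff_index_eq)
      with Suc False assms(1) show ?thesis by (simp add: assign_successors_take_Suc)
    qed
  qed simp
  from this[of "length hs"] assms show ?thesis by simp
qed

text \<open>The constant 1 in register 2 serves both as the loop step and to form the
  successor.\<close>

definition assign :: com where
  "assign = Seq (Length 0 2) (Seq (Const 2 1) (While 0
     (Seq (Read 4 1 1) (Seq (Add 4 4 2) (Seq (Read 5 2 1) (Seq (Write 0 5 4)
       (Seq (Add 1 1 2) (Sub 0 0 2))))))))"

lemma computes_assign:
  assumes "length gs = length hs"
  shows "computes assign [ys, gs, hs] [assign_successors ys gs hs] (7 * length hs + 3)"
proof -
  let ?Inv = "\<lambda>k R X. R 0 = length hs - k \<and> R 1 = k \<and> R 2 = 1 \<and>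
    X 0 = assign_successors ys (take k gs) (take k hs) \<and> X 1 = gs \<and> X 2 = hs"
  let ?R = "(\<lambda>_. 0)(0 := length hs, 2 := 1::nat)"
  have "\<exists>t R' X'. exec (While 0 (Seq (Read 4 1 1) (Seq (Add 4 4 2) (Seq (Read 5 2 1) (Seq (Write 0 5 4)
       (Seq (Add 1 1 2) (Sub 0 0 2)))))))
      ?R (init_arrays [ys, gs, hs]) t R' X' \<and> t \<le> length hs * (6 + 1) + 1 \<and> ?Inv (length hs) R' X'"
    by (rule exec_counting_loop)
      (auto simp: exec_simps exec_Seq init_arrays_def assms assign_successors_take_Suc,
       auto simp: assign_successors_def)
  then obtain t R' X' where loop: "exec (While 0 (Seq (Read 4 1 1) (Seq (Add 4 4 2) (Seq (Read 5 2 1)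
      (Seq (Write 0 5 4) (Seq (Add 1 1 2) (Sub 0 0 2))))))) ?R (init_arrays [ys, gs, hs]) t R' X'"
    and "t \<le> length hs * (6 + 1) + 1" "X' 0 = assign_successors ys gs hs"
    using assms by auto
  moreover have "exec assign (\<lambda>_. 0) (init_arrays [ys, gs, hs]) (1 + (1 + t)) R' X'"
    unfolding assign_def using loop
    by (intro exec.Seq) (auto simp: exec_simps init_arrays_def)
  ultimately show ?thesis
    unfolding computes_def by (intro exI[of _ "1 + (1 + t)"] exI[of _ R'] exI[of _ X']) auto
qed

section \<open>Repeated approximate matching\<close>

text \<open>The left-hand side of the last inequality is the cost of the edit script that keeps
  exactly the matched pairs, so this script is optimal up to the factor
  \<open>1 + \<epsilon>\<close>.\<close>

definition approximate_matching ::
    "real \<Rightarrow> 'a list \<Rightarrow> 'a list \<Rightarrow> nat list \<Rightarrow> nat list \<Rightarrow> nat list \<Rightarrow> bool" where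
  "approximate_matching \<epsilon> S S' d G H \<longleftrightarrow>
     sorted_wrt (<) G \<and> set G \<subseteq> {..<length S} \<and>
     sorted_wrt (<) H \<and> set H \<subseteq> {j. j < length S' \<and> d ! j = 0} \<and>
     map ((!) S) G = map ((!) S') H \<and>
     real (length S) + real (length (nths S' {j. d ! j = 0})) - 2 * real (length H)
       \<le> (1 + \<epsilon>) * real (ED S (nths S' {j. d ! j = 0}))"

locale repeated_matching =
  fixes \<epsilon> :: real and S S' :: "'a list" and G H D :: "nat \<Rightarrow> nat list" and K :: nat
  assumes matching: "r < K \<Longrightarrow> approximate_matching \<epsilon> S S' (D r) (G r) (H r)"
    and start: "D 0 = replicate (length S') 0"
    and next_D: "D (Suc r) = assign_successors (D r) (G r) (H r)"
begin

lemma length_D [simp]: "length (D r) = length S'"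
  by (induction r) (simp_all add: start next_D)

lemma matchingD:
  assumes "r < K"
  shows "sorted_wrt (<) (G r)" "set (G r) \<subseteq> {..<length S}" "sorted_wrt (<) (H r)"
    "set (H r) \<subseteq> {j. j < length S' \<and> D r ! j = 0}" "length (G r) = length (H r)"
    "\<And>c. c < length (H r) \<Longrightarrow> S ! (G r ! c) = S' ! (H r ! c)"
proof -
  note m = matching[OF assms, unfolded approximate_matching_def]
  show "sorted_wrt (<) (G r)" "set (G r) \<subseteq> {..<length S}" "sorted_wrt (<) (H r)"
    "set (H r) \<subseteq> {j. j < length S' \<and> D r ! j = 0}" using m by auto
  have eq: "map ((!) S) (G r) = map ((!) S') (H r)" using m by blast
  from arg_cong[OF this, of length] show len: "length (G r) = length (H r)" by simp
  show "S ! (G r ! c) = S' ! (H r ! c)" if "c < length (H r)" for c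
    using arg_cong[of _ _ "\<lambda>xs. xs ! c", OF eq] that len by simp
qed

lemma distinct_G: "r < K \<Longrightarrow> distinct (G r)" and distinct_H: "r < K \<Longrightarrow> distinct (H r)"
  using matchingD(1,3) strict_sorted_iff by auto

lemma D_Suc_matched:
  assumes "r < K" "c < length (H r)"
  shows "D (Suc r) ! (H r ! c) = Suc (G r ! c)"
  using nth_assign_successors[of "G r" "H r" "D r" c] matchingD(4,5)[OF assms(1)]
    distinct_H[OF assms(1)] assms(2)
  by (auto simp: next_D)

lemma D_Suc_unmatched: "r < K \<Longrightarrow> j \<notin> set (H r) \<Longrightarrow> D (Suc r) ! j = D r ! j"
  using nth_assign_successors_other[of "G r" "H r"] matchingD(5) by (simp add: next_D)

lemma D_Suc_eq_0_iff: "r < K \<Longrightarrow> D (Suc r) ! j = 0 \<longleftrightarrow> j \<notin> set (H r) \<and> D r ! j = 0"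
  using D_Suc_matched[of r] D_Suc_unmatched[of r j]
  by (cases "j \<in> set (H r)") (auto simp: in_set_conv_nth)

text \<open>Rounds write only nonzero entries. A symbol that is undecoded at the end therefore took
  part in every round.\<close>

lemma D_eq_0_earlier: "D s ! j = 0 \<Longrightarrow> r \<le> s \<Longrightarrow> s \<le> K \<Longrightarrow> D r ! j = 0"
proof (induction s)
  case (Suc s)
  then show ?case using D_Suc_eq_0_iff[of s j] by (cases "r = Suc s") auto
qed simp

text \<open>Every nonzero answer is traced back to the round that wrote it.\<close>

lemma D_eq_Suc:
  assumes "s \<le> K" "j < length S'" "D s ! j = Suc i"
  shows "\<exists>r<s. \<exists>c<length (H r). H r ! c = j \<and> G r ! c = i"
  using assms(1,3)
proof (induction s)
  case 0
  then show ?case using assms(2) by (simp add: start)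
next
  case (Suc s)
  show ?case
  proof (cases "j \<in> set (H s)")
    case True
    then obtain c where "c < length (H s)" "H s ! c = j" by (auto simp: in_set_conv_nth)
    with D_Suc_matched[of s c] Suc.prems show ?thesis by (intro exI[of _ s]) auto
  next
    case False
    with D_Suc_unmatched[of s j] Suc show ?thesis by (auto simp: less_Suc_eq)
  qed
qed

lemma D_le: "j < length S' \<Longrightarrow> D K ! j \<le> length S"
proof (cases "D K ! j")
  case (Suc i)
  assume "j < length S'"
  from D_eq_Suc[OF _ this Suc] obtain r c
    where r: "r < K" "c < length (H r)" "G r ! c = i" by auto
  then have "G r ! c \<in> set (G r)" using matchingD(5)[OF r(1)] by (intro nth_mem) simp
  then show ?thesis using matchingD(2)[OF r(1)] r(3) Suc by auto
qed simp

text \<open>Each list \<open>G r\<close> is distinct, so a round contributes at most one received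
  symbol per position.\<close>

lemma card_decoded_le: "card {j. j < length S' \<and> D K ! j = Suc i} \<le> K"
proof -
  let ?J = "\<lambda>r. {H r ! c | c. c < length (H r) \<and> G r ! c = i}"
  have single: "card (?J r) \<le> 1" if r: "r < K" for r
  proof -
    have "c = c'" if "c < length (H r)" "G r ! c = i" "c' < length (H r)" "G r ! c' = i" for c c'
      using that distinct_G[OF r] matchingD(5)[OF r] by (metis nth_eq_iff_index_eq)
    then have "\<exists>x. ?J r \<subseteq> {x}" by blast
    then show ?thesis using card_mono[of "{_}" "?J r"] by auto
  qed
  have "{j. j < length S' \<and> D K ! j = Suc i} \<subseteq> (\<Union>r<K. ?J r)"
    using D_eq_Suc[of K] by fastforce
  then have "card {j. j < length S' \<and> D K ! j = Suc i} \<le> card (\<Union>r<K. ?J r)"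
    by (intro card_mono) auto
  also have "\<dots> \<le> (\<Sum>r<K. card (?J r))"
    by (rule card_UN_le) simp
  also have "\<dots> \<le> (\<Sum>r<K. 1)"
    by (intro sum_mono) (use single in auto)
  finally show ?thesis by simp
qed

text \<open>Each round removes precisely the entries of \<open>H s\<close> from the undecoded
  positions, so different rounds match different symbols.\<close>

lemma sum_matched_le:
  "s \<le> K \<Longrightarrow> card {j. j < length S' \<and> D s ! j = 0} + (\<Sum>r<s. length (H r)) = length S'"
proof (induction s)
  case 0
  have "{j. j < length S' \<and> D 0 ! j = 0} = {..<length S'}" by (auto simp: start)
  then show ?case by simp
next
  case (Suc s)
  then have s: "s < K" by simp
  have "{j. j < length S' \<and> D (Suc s) ! j = 0} = {j. j < length S' \<and> D s ! j = 0} - set (H s)"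
    using D_Suc_eq_0_iff[OF s] by auto
  moreover have "card ({j. j < length S' \<and> D s ! j = 0} - set (H s)) =
      card {j. j < length S' \<and> D s ! j = 0} - length (H s)"
    using matchingD(4)[OF s] distinct_card[OF distinct_H[OF s]] by (simp add: card_Diff_subset)
  moreover have "length (H s) \<le> card {j. j < length S' \<and> D s ! j = 0}"
    using card_mono[OF _ matchingD(4)[OF s]] distinct_card[OF distinct_H[OF s]] by simp
  ultimately show ?case using Suc by simp
qed

end

section \<open>Counting undecoded and wrongly decoded symbols\<close>

locale repeated_matching_channel = repeated_matching +
  fixes Del Ins :: "nat set"
  assumes script: "edit_script S S' Del Ins"
begin

definition origin :: "nat \<Rightarrow> nat" where
  "origin j = (SOME i. i < length S \<and> arrives Del Ins i j)"

lemma origin_eq: "i < length S \<Longrightarrow> arrives Del Ins i j \<Longrightarrow> origin j = i"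
  unfolding origin_def by (rule some_equality) (auto dest: arrives_unique)

definition undecoded :: "nat set" where
  "undecoded = {j. j < length S' \<and> (\<exists>i<length S. arrives Del Ins i j) \<and> D K ! j = 0}"

text \<open>The symbols undecoded at the end are common to \<open>S\<close> and to the input of
  round \<open>r\<close>, which bounds the edit distance there and forces a large matching. The
  length of that input is finally replaced by \<open>length S'\<close>.\<close>

lemma undecoded_le_matching:
  assumes "r < K" "0 \<le> \<epsilon>"
  shows "2 * (1 + \<epsilon>) * real (card undecoded) \<le>
    2 * real (length (H r)) + \<epsilon> * (real (length S) + real (length S'))"
proof -
  define J where "J = sorted_list_of_set undecoded"
  let ?R = "nths S' {j. D r ! j = 0}"
  have fin: "finite undecoded" by (simp add: undecoded_def)
  have J: "sorted_wrt (<) J" "set J = undecoded" "length J = card undecoded"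
    using fin by (simp_all add: J_def)
  have origin: "origin j < length S \<and> arrives Del Ins (origin j) j \<and> S ! origin j = S' ! j"
    if "j \<in> undecoded" for j
    using that origin_eq[of _ j] edit_script_arrives[OF script] by (auto simp: undecoded_def)
  \<comment> \<open>Arrival preserves order, so the origins of increasing positions
    increase.\<close>
  have "sorted_wrt (<) (map origin J)"
    unfolding sorted_wrt_map
    by (rule sorted_wrt_mono_rel[OF _ J(1)]) (metis J(2) arrives_less_iff origin)
  then have "subseq (map ((!) S) (map origin J)) S"
    by (rule subseq_map_nth) (use J(2) origin in auto)
  moreover have "map ((!) S) (map origin J) = map ((!) S') J" using J(2) origin by simp
  ultimately have 1: "subseq (map ((!) S') J) S" by metis
  have R: "?R = map ((!) S') (nths [0..<length S'] {j. D r ! j = 0})"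
    by (simp add: map_nth flip: nths_map)
  have "subseq J (nths [0..<length S'] {j. D r ! j = 0})"
  proof (rule sorted_subset_imp_subseq)
    show "set J \<subseteq> set (nths [0..<length S'] {j. D r ! j = 0})"
    proof
      fix j assume "j \<in> set J"
      then have "j < length S'" "D r ! j = 0"
        using D_eq_0_earlier[of K j r] assms(1) by (simp_all add: J(2) undecoded_def)
      then show "j \<in> set (nths [0..<length S'] {j. D r ! j = 0})"
        by (auto simp: set_nths intro!: exI[of _ j])
    qed
  qed (use J(1) sorted_nths[of "[0..<length S']"] in auto)
  then have 2: "subseq (map ((!) S') J) ?R" unfolding R by (rule subseq_map)
  from ED_le_common_subseq[OF 1 2] J(3)
  have "real (ED S ?R) \<le> real (length S) + real (length ?R) - 2 * real (card undecoded)" by simp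
  from mult_left_mono[OF this, of "1 + \<epsilon>"] assms(2)
  have "(1 + \<epsilon>) * real (ED S ?R) \<le>
      (1 + \<epsilon>) * (real (length S) + real (length ?R) - 2 * real (card undecoded))" by simp
  moreover have "real (length S) + real (length ?R) - 2 * real (length (H r)) \<le> (1 + \<epsilon>) * real (ED S ?R)"
    using matching[OF assms(1)] by (simp add: approximate_matching_def)
  moreover have "\<epsilon> * real (length ?R) \<le> \<epsilon> * real (length S')"
    using assms(2) length_nths_le[of S'] by (intro mult_left_mono) simp_all
  ultimately show ?thesis by (simp add: algebra_simps)
qed

text \<open>The bounds of the single rounds are added up over all \<open>K\<close> rounds, whose
  matchings together have at most \<open>length S'\<close> pairs.\<close>

lemma card_undecoded_le:
  assumes "0 < K" "0 \<le> \<epsilon>" "real (length S') \<le> (1 + \<gamma>) * real (length S)"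
  shows "real (card undecoded) \<le> real (length S) *
    ((1 + \<gamma>) / (real K * (1 + \<epsilon>)) + \<epsilon> * (1 + \<gamma> / 2) / (1 + \<epsilon>))"
proof -
  let ?n = "real (length S)" and ?m = "real (length S')"
  have "real K * (2 * (1 + \<epsilon>) * real (card undecoded)) = (\<Sum>r<K. 2 * (1 + \<epsilon>) * real (card undecoded))"
    by simp
  also have "\<dots> \<le> (\<Sum>r<K. 2 * real (length (H r)) + \<epsilon> * (?n + ?m))"
    using undecoded_le_matching assms(2) by (intro sum_mono) simp
  also have "\<dots> = 2 * real (\<Sum>r<K. length (H r)) + real K * (\<epsilon> * (?n + ?m))"
    by (simp add: sum.distrib sum_distrib_left)
  also have "\<dots> \<le> 2 * ?m + real K * (\<epsilon> * (?n + ?m))"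
    using sum_matched_le[of K] by (simp flip: of_nat_sum)
  also have "\<dots> \<le> 2 * ((1 + \<gamma>) * ?n) + real K * (\<epsilon> * (?n + (1 + \<gamma>) * ?n))"
    using assms by (intro add_mono mult_left_mono) simp_all
  \<comment> \<open>Here \<open>1 + (1 + \<gamma>) = 2 * (1 + \<gamma> / 2)\<close>, and the common
    factor 2 cancels.\<close>
  finally have "real (card undecoded) * (real K * (1 + \<epsilon>)) \<le>
      ?n * ((1 + \<gamma>) + real K * (\<epsilon> * (1 + \<gamma> / 2)))" by (simp add: algebra_simps)
  then have "real (card undecoded) \<le> ?n * ((1 + \<gamma>) + real K * (\<epsilon> * (1 + \<gamma> / 2))) / (real K * (1 + \<epsilon>))"
    using assms by (simp add: pos_le_divide_eq)
  also have "\<dots> = ?n * ((1 + \<gamma>) / (real K * (1 + \<epsilon>)) + \<epsilon> * (1 + \<gamma> / 2) / (1 + \<epsilon>))"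
    using assms(1) unfolding times_divide_eq_right[symmetric] add_divide_distrib[of "1 + \<gamma>"]
    by (simp add: mult_divide_mult_cancel_left_if)
  finally show ?thesis .
qed

text \<open>The first component is the true origin, the second the position guessed. Inserted
  symbols have no origin and are filtered out.\<close>

definition wrong_pairs :: "nat \<Rightarrow> (nat \<times> nat) list" where
  "wrong_pairs r = map (\<lambda>(g, h). (origin h, g))
     (filter (\<lambda>(g, h). \<exists>i<length S. arrives Del Ins i h \<and> i \<noteq> g) (zip (G r) (H r)))"

lemma strict_chain_wrong_pairs:
  assumes "r < K"
  shows "strict_chain (wrong_pairs r)"
proof -
  have "sorted_wrt (\<lambda>p q. fst p < fst q \<and> snd p < snd q) (zip (G r) (H r))"
    using matchingD(1,3,5)[OF assms] by (auto simp: sorted_wrt_iff_nth_less)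
  then show ?thesis
    unfolding strict_chain_def wrong_pairs_def sorted_wrt_map
    by (rule sorted_wrt_mono_rel[rotated, OF sorted_wrt_filter])
      (auto simp: origin_eq arrives_less_iff)
qed

text \<open>Both symbols of \<open>S\<close> equal the received symbol: one because it arrived
  there, the other because the round matched it.\<close>

lemma set_wrong_pairs:
  assumes "r < K" "(a, b) \<in> set (wrong_pairs r)"
  shows "a < length S \<and> b < length S \<and> a \<noteq> b \<and> S ! a = S ! b"
proof -
  from assms(2) obtain h i where "(b, h) \<in> set (zip (G r) (H r))" "a = origin h"
    and i: "i < length S" "arrives Del Ins i h" "i \<noteq> b"
    by (auto simp: wrong_pairs_def)
  then obtain c where c: "c < length (H r)" "G r ! c = b" "H r ! c = h"
    by (auto simp: in_set_zip)
  have "h < length S'" "b < length S"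
    using c matchingD(2,4,5)[OF assms(1)] nth_mem[of c "G r"] nth_mem[of c "H r"] by auto
  then show ?thesis
    using i c matchingD(6)[OF assms(1) c(1)] edit_script_arrives[OF script i(2)] origin_eq[OF i(1,2)]
      \<open>a = origin h\<close> by simp
qed

text \<open>A misdecoded symbol has answer 0, or a wrong answer that some round wrote.\<close>

lemma misdecodings_subset:
  "misdecodings (length S) Del Ins (map decoded (D K)) \<subseteq>
     origin ` undecoded \<union> (\<Union>r<K. fst ` set (wrong_pairs r))"
proof
  fix i assume "i \<in> misdecodings (length S) Del Ins (map decoded (D K))"
  then obtain j where i: "i < length S" and j: "j < length S'" "arrives Del Ins i j"
    and wrong: "decoded (D K ! j) \<noteq> Some i"
    by (auto simp: misdecodings_def)
  have o: "origin j = i" using origin_eq[OF i j(2)] .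
  show "i \<in> origin ` undecoded \<union> (\<Union>r<K. fst ` set (wrong_pairs r))"
  proof (cases "D K ! j")
    case 0
    then have "j \<in> undecoded" using i j by (auto simp: undecoded_def)
    then show ?thesis using o by auto
  next
    case (Suc g)
    from D_eq_Suc[OF _ j(1) Suc] obtain r c
      where r: "r < K" "c < length (H r)" "H r ! c = j" "G r ! c = g" by auto
    then have "(g, j) \<in> set (zip (G r) (H r))"
      using matchingD(5)[OF r(1)] by (auto simp: in_set_zip)
    then have "(i, g) \<in> set (wrong_pairs r)"
      using i j(2) wrong Suc o by (force simp: wrong_pairs_def)
    with r(1) show ?thesis by force
  qed
qed

text \<open>The map \<open>f\<close> projects symbols to the synchronization string. Equal symbols
  have equal images, so the wrong pairs of each round become a self-matching of that string.\<close>

lemma card_misdecodings_le: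
  assumes "sync_string \<epsilon>s (map f S)" "0 \<le> \<epsilon>s"
  shows "real (card (misdecodings (length S) Del Ins (map decoded (D K))))
    \<le> real (card undecoded) + real K * (\<epsilon>s * real (length S))"
proof -
  have fin: "finite undecoded" by (simp add: undecoded_def)
  have "card (misdecodings (length S) Del Ins (map decoded (D K)))
      \<le> card (origin ` undecoded \<union> (\<Union>r<K. fst ` set (wrong_pairs r)))"
    by (rule card_mono[OF _ misdecodings_subset]) (simp add: fin)
  also have "\<dots> \<le> card (origin ` undecoded) + card (\<Union>r<K. fst ` set (wrong_pairs r))"
    by (rule card_Un_le)
  also have "\<dots> \<le> card undecoded + (\<Sum>r<K. card (fst ` set (wrong_pairs r)))"
    by (intro add_mono card_image_le card_UN_le fin) simp
  also have "\<dots> \<le> card undecoded + (\<Sum>r<K. length (wrong_pairs r))"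
    by (intro add_left_mono sum_mono) (metis List.finite_set card_image_le card_length order_trans)
  finally have "real (card (misdecodings (length S) Del Ins (map decoded (D K))))
      \<le> real (card undecoded) + (\<Sum>r<K. real (length (wrong_pairs r)))"
    by (simp flip: of_nat_sum of_nat_add)
  also have "\<dots> \<le> real (card undecoded) + (\<Sum>r<K. \<epsilon>s * real (length S))"
  proof (intro add_left_mono sum_mono)
    fix r assume "r \<in> {..<K}"
    then have r: "r < K" by simp
    have "a < length (map f S) \<and> b < length (map f S) \<and> a \<noteq> b \<and> map f S ! a = map f S ! b"
      if "(a, b) \<in> set (wrong_pairs r)" for a b
      using set_wrong_pairs[OF r that] by simp
    from sync_string_self_matching[OF assms strict_chain_wrong_pairs[OF r] this]
    show "real (length (wrong_pairs r)) \<le> \<epsilon>s * real (length S)" by simp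
  qed
  finally show ?thesis by simp
qed

end

section \<open>The decoding program\<close>

text \<open>Arrays 0 to 3 hold the components of \<open>S\<close> and \<open>S'\<close>, array 4 the answers so far, where 0 marks the
  symbols that still take part.  Arrays 9, 10 and 11 receive the components and the positions of
  these symbols, arrays 12 and 13 the edit script, arrays 16 and 17 the matched positions.  The
  first two calls of \<open>assign\<close> serve to flag the deleted and the inserted positions: any nonzero
  values would do.\<close>

definition decoding_round :: "com \<Rightarrow> com" where
  "decoding_round A =
     Seq (Call iota_zeros [0] [0, 5, 6])
    (Seq (Call iota_zeros [4] [4, 7, 8])
    (Seq (Call select [4, 2] [4, 2, 9])
    (Seq (Call select [4, 3] [4, 3, 10])
    (Seq (Call select [4, 7] [4, 7, 11])
    (Seq (Call A [0, 1, 9, 10] [12, 13])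
    (Seq (Call iota_zeros [11] [11, 14, 15])
    (Seq (Call assign [6, 12, 12] [6])
    (Seq (Call assign [15, 13, 13] [15])
    (Seq (Call select [6, 5] [6, 5, 16])
    (Seq (Call select [15, 11] [15, 11, 17])
         (Call assign [4, 16, 17] [4])))))))))))"

text \<open>Successors are nonzero, so the result is a flag array for the listed positions, as
  \<open>select\<close> expects.\<close>

lemma assign_successors_zeros:
  assumes "distinct D" "set D \<subseteq> {..<n}" "j < n"
  shows "assign_successors (replicate n 0) D D ! j = 0 \<longleftrightarrow> j \<notin> set D"
proof (cases "j \<in> set D")
  case True
  then obtain c where "c < length D" "D ! c = j" by (auto simp: in_set_conv_nth)
  with nth_assign_successors[of D D "replicate n 0" c] assms True show ?thesis by simp
next
  case False
  with nth_assign_successors_other[of D D j "replicate n 0"] assms(3) show ?thesis by simp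
qed

text \<open>\<open>Ins\<close> refers to positions in the shortened string; selecting from
  \<open>P\<close> translates the remaining ones into positions of \<open>S'\<close>.\<close>

lemma computes_decoding_round:
  fixes S S' :: "(nat \<times> nat) list" and d Del Ins :: "nat list"
  defines "P \<equiv> nths [0..<length d] {j. d ! j = 0}"
  defines "G \<equiv> nths [0..<length S] (- set Del)"
  defines "H \<equiv> nths P (- set Ins)"
  assumes len: "length d = length S'"
    and A: "computes A [map fst S, map snd S, map fst (nths S' {j. d ! j = 0}),
      map snd (nths S' {j. d ! j = 0})] [Del, Ins] t"
    and Del: "distinct Del" "set Del \<subseteq> {..<length S}"
    and Ins: "distinct Ins" "set Ins \<subseteq> {..<length P}"
    and GH: "length G = length H"
  shows "computes (decoding_round A) [map fst S, map snd S, map fst S', map snd S', d]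
     [map fst S, map snd S, map fst S', map snd S', assign_successors d G H]
     (t + 200 * (length S + length S' + 1))"
proof -
  let ?n = "length S" and ?m = "length S'"
  let ?Z = "{j. d ! j = 0}"
  let ?T = "map fst S" and ?I = "map snd S" and ?U = "map fst S'" and ?V = "map snd S'"
  let ?U' = "map fst (nths S' ?Z)" and ?V' = "map snd (nths S' ?Z)"
  let ?FD = "assign_successors (replicate ?n 0) Del Del"
  let ?FI = "assign_successors (replicate (length P) 0) Ins Ins"
  have lenP: "length P \<le> ?m"
    unfolding P_def using length_nths_le[of "[0..<length d]"] len by simp
  have lenDel: "length Del \<le> ?n" "length Ins \<le> ?m"
    using Del Ins lenP by (metis card_lessThan card_mono distinct_card finite_lessThan order_trans)+
  have lenU': "length (nths S' ?Z) = length P" unfolding P_def using len by (simp add: length_nths)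
  have lenG: "length G \<le> ?n"
    unfolding G_def using length_nths_le[of "[0..<?n]"] by simp
  have G: "nths [0..<?n] {j. ?FD ! j = 0} = G"
    unfolding G_def using assign_successors_zeros[OF Del] by (intro nths_cong) auto
  have H: "nths P {j. ?FI ! j = 0} = H"
    unfolding H_def using assign_successors_zeros[OF Ins] by (intro nths_cong) auto
  define X0 where "X0 = init_arrays [?T, ?I, ?U, ?V, d]"
  have X0: "X0 0 = ?T" "X0 (Suc 0) = ?I" "X0 2 = ?U" "X0 3 = ?V" "X0 4 = d"
    by (simp_all add: X0_def init_arrays_def)
  define N where "N = ?n + ?m + 1"
  define X1 where "X1 = store [0, 5, 6] [?T, [0..<?n], replicate ?n 0] X0"
  have 1: "transforms (Call iota_zeros [0] [0, 5, 6]) X0 X1 (15 * N)"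
    using computes_iota_zeros[of ?T] unfolding X1_def
    by (intro transforms_Call_le[where t = "5 * ?n + 3"]) (auto simp: X0 N_def)
  define X2 where "X2 = store [4, 7, 8] [d, [0..<?m], replicate ?m 0] X1"
  have 2: "transforms (Call iota_zeros [4] [4, 7, 8]) X1 X2 (15 * N)"
    using computes_iota_zeros[of d] unfolding X2_def
    by (intro transforms_Call_le[where t = "5 * ?m + 3"]) (auto simp: X1_def X0 N_def len)
  define X3 where "X3 = store [4, 2, 9] [d, ?U, ?U'] X2"
  have 3: "transforms (Call select [4, 2] [4, 2, 9]) X2 X3 (15 * N)"
    using computes_select[of d ?U] len lenU' lenP unfolding X3_def
    by (intro transforms_Call_le[where t = "7 * ?m + 3"]) (auto simp: X2_def X1_def X0 N_def nths_map)
  define X4 where "X4 = store [4, 3, 10] [d, ?V, ?V'] X3"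
  have 4: "transforms (Call select [4, 3] [4, 3, 10]) X3 X4 (15 * N)"
    using computes_select[of d ?V] len lenU' lenP unfolding X4_def
    by (intro transforms_Call_le[where t = "7 * ?m + 3"]) (auto simp: X3_def X2_def X1_def X0 N_def nths_map)
  define X5 where "X5 = store [4, 7, 11] [d, [0..<?m], P] X4"
  have 5: "transforms (Call select [4, 7] [4, 7, 11]) X4 X5 (15 * N)"
    using computes_select[of d "[0..<?m]"] len lenP unfolding X5_def
    by (intro transforms_Call_le[where t = "7 * ?m + 3"]) (auto simp: X4_def X3_def X2_def X1_def X0 N_def P_def)
  define X6 where "X6 = store [12, 13] [Del, Ins] X5"
  have 6: "transforms (Call A [0, 1, 9, 10] [12, 13]) X5 X6 (t + 15 * N)"
    using A lenDel lenU' lenP unfolding X6_def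
    by (intro transforms_Call_le[where t = t]) (auto simp: X5_def X4_def X3_def X2_def X1_def X0 N_def)
  define X7 where "X7 = store [11, 14, 15] [P, [0..<length P], replicate (length P) 0] X6"
  have 7: "transforms (Call iota_zeros [11] [11, 14, 15]) X6 X7 (15 * N)"
    using computes_iota_zeros[of P] lenP unfolding X7_def
    by (intro transforms_Call_le[where t = "5 * length P + 3"]) (auto simp: X6_def X5_def N_def)
  define X8 where "X8 = store [6] [?FD] X7"
  have 8: "transforms (Call assign [6, 12, 12] [6]) X7 X8 (15 * N)"
    using computes_assign[of Del Del "replicate ?n 0"] lenDel unfolding X8_def
    by (intro transforms_Call_le[where t = "7 * length Del + 3"])
      (auto simp: X7_def X6_def X5_def X4_def X3_def X2_def X1_def X0 N_def)
  define X9 where "X9 = store [15] [?FI] X8"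
  have 9: "transforms (Call assign [15, 13, 13] [15]) X8 X9 (15 * N)"
    using computes_assign[of Ins Ins "replicate (length P) 0"] lenDel lenP unfolding X9_def
    by (intro transforms_Call_le[where t = "7 * length Ins + 3"]) (auto simp: X8_def X7_def X6_def N_def)
  define X10 where "X10 = store [6, 5, 16] [?FD, [0..<?n], G] X9"
  have 10: "transforms (Call select [6, 5] [6, 5, 16]) X9 X10 (15 * N)"
    using computes_select[of ?FD "[0..<?n]"] lenG G unfolding X10_def
    by (intro transforms_Call_le[where t = "7 * ?n + 3"])
      (auto simp: X9_def X8_def X7_def X6_def X5_def X4_def X3_def X2_def X1_def X0 N_def)
  define X11 where "X11 = store [15, 11, 17] [?FI, P, H] X10"
  have 11: "transforms (Call select [15, 11] [15, 11, 17]) X10 X11 (15 * N)"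
    using computes_select[of ?FI P] lenG lenP GH H unfolding X11_def
    by (intro transforms_Call_le[where t = "7 * length P + 3"])
      (auto simp: X10_def X9_def X8_def X7_def N_def)
  define X12 where "X12 = store [4] [assign_successors d G H] X11"
  have 12: "transforms (Call assign [4, 16, 17] [4]) X11 X12 (15 * N)"
    using computes_assign[of G H d] lenG GH len unfolding X12_def
    by (intro transforms_Call_le[where t = "7 * length H + 3"])
      (auto simp: X11_def X10_def X9_def X8_def X7_def X6_def X5_def N_def)
  \<comment> \<open>The twelve calls cost at most \<open>15 * N\<close> each, apart from the time
    \<open>t\<close> of \<open>A\<close> itself.\<close>
  have "transforms (decoding_round A) X0 X12 (t + 200 * N)"
    unfolding decoding_round_def
    by (rule transforms_mono,
       (rule transforms_Seq, rule 1 2 3 4 5 6 7 8 9 10 11)+, rule 12, simp)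
  then show ?thesis unfolding X0_def N_def
    by (rule computes_transforms)
      (auto simp: less_Suc_eq numeral_eq_Suc X12_def X11_def X10_def X9_def X8_def X7_def X6_def X5_def
        X4_def X3_def X2_def X1_def X0)
qed

text \<open>The remaining symbols form a string over the same alphabet and no longer than
  \<open>S'\<close>, so the guarantee for \<open>A\<close> applies with the same
  \<open>r\<close>.\<close>

lemma decoding_round_correct:
  fixes S S' :: "(nat \<times> nat) list"
  assumes idx: "indexing_sequence \<epsilon> \<tau> \<Sigma>I I A" and S: "S = zip T I" "length T = length I"
    and S': "set S' \<subseteq> UNIV \<times> \<Sigma>I" "real (length S') \<le> r * real (length I)"
    and d: "length d = length S'"
  shows "\<exists>G H t. approximate_matching \<epsilon> S S' d G H \<and>
    real t \<le> \<tau> r (length I) + 200 * real (length S + length S' + 1) \<and>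
    computes (decoding_round A) [map fst S, map snd S, map fst S', map snd S', d]
      [map fst S, map snd S, map fst S', map snd S', assign_successors d G H] t"
proof -
  let ?R = "nths S' {j. d ! j = 0}"
  define P where "P = nths [0..<length S'] {j. d ! j = 0}"
  have "set ?R \<subseteq> UNIV \<times> \<Sigma>I" using S'(1) set_nths_subset[of S'] by blast
  moreover have "real (length ?R) \<le> r * real (length I)"
    using S'(2) length_nths_le[of S' "{j. d ! j = 0}"] by simp
  ultimately obtain t Y where run: "runs_on A S ?R t Y" and t: "real t \<le> \<tau> r (length I)"
    and Y: "distinct (Y 0)" "distinct (Y 1)" "edit_script S ?R (set (Y 0)) (set (Y 1))"
    and cost: "real (length (Y 0) + length (Y 1)) \<le> (1 + \<epsilon>) * real (ED S ?R)"
    using idx S unfolding indexing_sequence_def by blast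
  define G where "G = nths [0..<length S] (- set (Y 0))"
  define H where "H = nths P (- set (Y 1))"
  have sub: "set (Y 0) \<subseteq> {..<length S}" "set (Y 1) \<subseteq> {..<length ?R}"
    and eq: "nths S (- set (Y 0)) = nths ?R (- set (Y 1))"
    using Y(3) by (simp_all add: edit_script_def)
  have R: "?R = map ((!) S') P" unfolding P_def by (simp add: map_nth flip: nths_map)
  then have lenR: "length ?R = length P" by simp
  have GH: "map ((!) S) G = map ((!) S') H"
    using eq unfolding G_def H_def R by (simp add: map_nth flip: nths_map)
  from arg_cong[OF this, of length] have len: "length G = length H" by simp
  have strict: "sorted_wrt (<) (nths xs B)" if "sorted_wrt (<) xs" for xs :: "nat list" and B
    using that by (simp add: strict_sorted_iff sorted_nths)
  have "length G + length (Y 0) = length S"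
    using length_nths_Compl[of "set (Y 0)" "[0..<length S]"] sub(1) distinct_card[OF Y(1)]
    by (simp add: G_def)
  moreover have "length H + length (Y 1) = length ?R"
    using length_nths_Compl[of "set (Y 1)" P] sub(2) distinct_card[OF Y(2)] lenR
    by (simp add: H_def)
  \<comment> \<open>Unmatched symbols are exactly the listed deletions and insertions, and
    \<open>G\<close> and \<open>H\<close> have equal length.\<close>
  ultimately have "real (length S) + real (length ?R) - 2 * real (length H) \<le> (1 + \<epsilon>) * real (ED S ?R)"
    using cost len by linarith
  moreover have "set H \<subseteq> {j. j < length S' \<and> d ! j = 0}"
    using set_nths_subset[of P "- set (Y 1)"] by (auto simp: H_def P_def set_nths)
  moreover have "set G \<subseteq> {..<length S}"
    using set_nths_subset[of "[0..<length S]" "- set (Y 0)"] by (auto simp: G_def)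
  moreover have "sorted_wrt (<) G" "sorted_wrt (<) H"
    unfolding G_def H_def P_def by (intro strict sorted_wrt_upt)+
  ultimately have "approximate_matching \<epsilon> S S' d G H"
    using GH by (simp add: approximate_matching_def)
  moreover have "computes A [map fst S, map snd S, map fst ?R, map snd ?R] [Y 0, Y 1] t"
    using run unfolding computes_def runs_on_def by (auto simp: less_Suc_eq)
  from computes_decoding_round[OF d this Y(1) sub(1) Y(2)] sub(2) lenR len
  have "computes (decoding_round A) [map fst S, map snd S, map fst S', map snd S', d]
      [map fst S, map snd S, map fst S', map snd S', assign_successors d G H]
      (t + 200 * (length S + length S' + 1))"
    by (simp add: G_def H_def P_def d)
  moreover have "real (t + 200 * (length S + length S' + 1)) \<le>
      \<tau> r (length I) + 200 * real (length S + length S' + 1)" using t by simp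
  ultimately show ?thesis by blast
qed

section \<open>Iterating the rounds\<close>

lemma transforms_funpow:
  assumes step: "\<And>d X. Inv d X \<Longrightarrow> \<exists>X'. transforms c X X' t \<and> Inv (f d) X'"
    and last: "\<And>d X. Inv d X \<Longrightarrow> \<exists>X'. transforms e X X' u \<and> Q d X'"
  shows "Inv d X \<Longrightarrow> \<exists>X'. transforms ((Seq c ^^ K) e) X X' (K * t + u) \<and> Q ((f ^^ K) d) X'"
proof (induction K arbitrary: d X)
  case 0
  with last show ?case by simp
next
  case (Suc K)
  from step[OF Suc.prems] obtain X1 where X1: "transforms c X X1 t" "Inv (f d) X1" by blast
  from Suc.IH[OF X1(2)] obtain X2
    where X2: "transforms ((Seq c ^^ K) e) X1 X2 (K * t + u)" "Q ((f ^^ K) (f d)) X2" by blast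
  have "transforms ((Seq c ^^ Suc K) e) X X2 (Suc K * t + u)"
    using transforms_Seq[OF X1(1) X2(1)] by (simp add: add.assoc)
  with X2(2) show ?case by (metis funpow_swap1 funpow_simps_right(2) comp_apply)
qed

text \<open>The rounds are unrolled, with \<open>K\<close> fixed in the program. The first call puts
  zeros into array 4. The last call leaves its input array unchanged and only copies array 4 to
  array 0.\<close>

definition decoder :: "com \<Rightarrow> nat \<Rightarrow> com" where
  "decoder A K = Seq (Call iota_zeros [2] [2, 5, 4])
     ((Seq (Call (decoding_round A) [0, 1, 2, 3, 4] [0, 1, 2, 3, 4]) ^^ K)
       (Call (Const 0 0) [4] [0]))"

lemma computes_decoder:
  fixes S S' :: "(nat \<times> nat) list"
  assumes round: "\<And>d. length d = length S' \<Longrightarrow> length (f d) = length S' \<and>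
      computes (decoding_round A) [map fst S, map snd S, map fst S', map snd S', d]
        [map fst S, map snd S, map fst S', map snd S', f d] t"
  shows "computes (decoder A K) [map fst S, map snd S, map fst S', map snd S']
    [(f ^^ K) (replicate (length S') 0)]
    (K * (t + 10 * (length S + length S' + 1)) + 20 * (length S + length S' + 1))"
proof -
  let ?N = "length S + length S' + 1"
  let ?T = "map fst S" and ?I = "map snd S" and ?U = "map fst S'" and ?V = "map snd S'"
  define Inv where "Inv = (\<lambda>d (X::arrays). X 0 = ?T \<and> X 1 = ?I \<and> X 2 = ?U \<and> X 3 = ?V \<and> X 4 = d \<and>
    length d = length S')"
  define X0 where "X0 = init_arrays [?T, ?I, ?U, ?V]"
  have X0: "X0 0 = ?T" "X0 1 = ?I" "X0 2 = ?U" "X0 3 = ?V"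
    by (simp_all add: X0_def init_arrays_def)
  let ?X1 = "store [2, 5, 4] [?U, [0..<length S'], replicate (length S') 0] X0"
  have 1: "transforms (Call iota_zeros [2] [2, 5, 4]) X0 ?X1 (10 * ?N)"
    using computes_iota_zeros[of ?U]
    by (intro transforms_Call_le[where t = "5 * length S' + 3"]) (auto simp: X0)
  have Inv1: "Inv (replicate (length S') 0) ?X1" using X0 by (simp add: Inv_def)
  have step: "\<exists>X'. transforms (Call (decoding_round A) [0, 1, 2, 3, 4] [0, 1, 2, 3, 4]) X X'
      (t + 10 * ?N) \<and> Inv (f d) X'" if "Inv d X" for d X
  proof (intro exI conjI)
    show "transforms (Call (decoding_round A) [0, 1, 2, 3, 4] [0, 1, 2, 3, 4]) X
        (store [0, 1, 2, 3, 4] [?T, ?I, ?U, ?V, f d] X) (t + 10 * ?N)"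
      using that round[of d] unfolding Inv_def
      by (intro transforms_Call_le[where t = t]) auto
    show "Inv (f d) (store [0, 1, 2, 3, 4] [?T, ?I, ?U, ?V, f d] X)"
      using that round[of d] by (simp add: Inv_def)
  qed
  have last: "\<exists>X'. transforms (Call (Const 0 0) [4] [0]) X X' (10 * ?N) \<and> X' 0 = d" if "Inv d X" for d X
  proof (intro exI conjI)
    have "computes (Const 0 0) [d] [d] 1"
      by (auto simp: computes_def exec_simps init_arrays_def)
    then show "transforms (Call (Const 0 0) [4] [0]) X (store [0] [d] X) (10 * ?N)"
      using that unfolding Inv_def by (intro transforms_Call_le[where t = 1]) auto
  qed simp
  from transforms_funpow[where Inv = Inv and f = f and K = K and Q = "\<lambda>d X. X 0 = d", OF step last Inv1] obtain X'
    where X': "transforms ((Seq (Call (decoding_round A) [0, 1, 2, 3, 4] [0, 1, 2, 3, 4]) ^^ K)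
        (Call (Const 0 0) [4] [0])) ?X1 X' (K * (t + 10 * ?N) + 10 * ?N)"
      "X' 0 = (f ^^ K) (replicate (length S') 0)" by blast
  have "transforms (decoder A K) X0 X' (K * (t + 10 * ?N) + 20 * ?N)"
    unfolding decoder_def
    by (rule transforms_mono[OF transforms_Seq[OF 1 X'(1)]]) simp
  then show ?thesis
    unfolding X0_def by (rule computes_transforms) (simp add: X'(2))
qed

section \<open>Running time and final bounds\<close>

lemma near_linear_add_affine:
  assumes "near_linear f"
  shows "near_linear (\<lambda>n. f n + C * (B * real n + 1))"
proof -
  from assms obtain p :: nat where p: "f \<in> O(\<lambda>n. real n * ln (real n) ^ p)"
    by (auto simp: near_linear_def)
  have "(\<lambda>n. C * (B * real n + 1)) \<in> O(\<lambda>n. real n * ln (real n) ^ p)"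
  \<comment> \<open>From 3 on, \<open>real n\<close> exceeds \<open>exp 1\<close>, so the powers of
    the logarithm are at least 1.\<close>
  proof (rule bigoI[of _ "\<bar>C\<bar> * (\<bar>B\<bar> + 1)"], use eventually_ge_at_top[of 3] in eventually_elim)
    fix n :: nat assume n: "3 \<le> n"
    have "exp 1 \<le> real n" using n exp_le by linarith
    then have "1 \<le> ln (real n)" using n by (subst ln_ge_iff) auto
    then have "1 \<le> ln (real n) ^ p" by simp
    from mult_left_mono[OF this, of "real n"]
    have ln: "real n \<le> real n * ln (real n) ^ p" by simp
    have "\<bar>B * real n + 1\<bar> \<le> \<bar>B\<bar> * real n + 1"
      using abs_triangle_ineq[of "B * real n" 1] by (simp add: abs_mult)
    also have "\<dots> \<le> (\<bar>B\<bar> + 1) * real n" using n by (simp add: algebra_simps)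
    also have "\<dots> \<le> (\<bar>B\<bar> + 1) * (real n * ln (real n) ^ p)"
      using ln by (intro mult_left_mono) auto
    finally have "\<bar>C\<bar> * \<bar>B * real n + 1\<bar> \<le> \<bar>C\<bar> * ((\<bar>B\<bar> + 1) * (real n * ln (real n) ^ p))"
      by (rule mult_left_mono) simp
    then show "norm (C * (B * real n + 1)) \<le>
        \<bar>C\<bar> * (\<bar>B\<bar> + 1) * norm (real n * ln (real n) ^ p)"
      using ln n by (simp add: abs_mult mult.assoc)
  qed
  with p show ?thesis unfolding near_linear_def by (intro exI[of _ p] sum_in_bigo)
qed

lemma decoder_correct:
  fixes S S' :: "(nat \<times> nat) list"
  assumes pos: "0 < \<epsilon>I" "0 \<le> \<gamma>" "0 \<le> \<epsilon>s" "0 < K"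
    and T: "length T = n" "length I = n" "sync_string \<epsilon>s T"
    and idx: "indexing_sequence \<epsilon>I \<tau> \<Sigma>I I A" and S: "S = zip T I"
    and S': "set S' \<subseteq> UNIV \<times> \<Sigma>I" and chan: "channel \<delta> \<gamma> S S' Del Ins"
  shows "\<exists>t dec. decodes_to (decoder A K) S S' t dec \<and>
    real t \<le> real K * (\<tau> (1 + \<gamma>) n + 230 * ((2 + \<gamma>) * real n + 1)) \<and>
    real (card (misdecodings n Del Ins dec)) \<le> real n * ((1 + \<gamma>) / (real K * (1 + \<epsilon>I))
      + \<epsilon>I * (1 + \<gamma> / 2) / (1 + \<epsilon>I) + real K * \<epsilon>s) \<and>
    (\<forall>i<n. card {j. j < length S' \<and> dec ! j = Some i} \<le> K)"
proof -
  have lenS: "length S = n" and fstS: "map fst S = T" using T S by simp_all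
  have m: "real (length S') \<le> (1 + \<gamma>) * real n"
    using channel_length[OF chan] lenS by simp
  define b where "b = \<tau> (1 + \<gamma>) n + 200 * real (length S + length S' + 1)"
  \<comment> \<open>The length condition stands inside the existential quantifiers, so that choice
    yields total functions and a round becomes a function of the answer array.\<close>
  have "\<forall>d. \<exists>G H t. length d = length S' \<longrightarrow> approximate_matching \<epsilon>I S S' d G H \<and> real t \<le> b \<and>
      computes (decoding_round A) [map fst S, map snd S, map fst S', map snd S', d]
        [map fst S, map snd S, map fst S', map snd S', assign_successors d G H] t"
    using decoding_round_correct[OF idx S _ S', of "1 + \<gamma>"] T m unfolding b_def by metis
  then obtain g h t where step: "\<And>d. length d = length S' \<Longrightarrow>
      approximate_matching \<epsilon>I S S' d (g d) (h d) \<and> real (t d) \<le> b \<and>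
      computes (decoding_round A) [map fst S, map snd S, map fst S', map snd S', d]
        [map fst S, map snd S, map fst S', map snd S', assign_successors d (g d) (h d)] (t d)"
    by metis
  define f where "f d = assign_successors d (g d) (h d)" for d
  define D where "D r = (f ^^ r) (replicate (length S') 0)" for r
  \<comment> \<open>The sign of \<open>b\<close> follows from the existence of one round whose
    running time it bounds.\<close>
  have "real (t (replicate (length S') 0)) \<le> b" using step by simp
  then have b: "0 \<le> b" by linarith
  have length_f: "length d = length S' \<Longrightarrow> length (f d) = length S'" for d by (simp add: f_def)
  have length_D: "length (D r) = length S'" for r
    by (induction r) (simp_all add: D_def length_f)
  interpret repeated_matching_channel \<epsilon>I S S' "\<lambda>r. g (D r)" "\<lambda>r. h (D r)" D K Del Ins
    using step length_D chan by unfold_locales (simp_all add: D_def f_def channel_def)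
  have "computes (decoding_round A) [map fst S, map snd S, map fst S', map snd S', d]
      [map fst S, map snd S, map fst S', map snd S', f d] (nat \<lfloor>b\<rfloor>)" if "length d = length S'" for d
    using step[OF that] le_nat_floor[of "t d" b] unfolding f_def computes_def by (meson order_trans)
  from computes_decoder[of S' f A S, OF conjI, OF length_f this] obtain u R Y
    where Y: "exec (decoder A K) (\<lambda>_. 0) (init_arrays [map fst S, map snd S, map fst S', map snd S']) u R Y"
      "Y 0 = D K"
      and u: "u \<le> K * (nat \<lfloor>b\<rfloor> + 10 * (length S + length S' + 1)) + 20 * (length S + length S' + 1)"
    unfolding computes_def D_def by fastforce
  have "set (map decoded (D K)) \<subseteq> insert None (Some ` {..<length S})"
  proof
    fix x assume "x \<in> set (map decoded (D K))"
    then obtain j where "j < length S'" "x = decoded (D K ! j)"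
      by (auto simp: in_set_conv_nth length_D)
    with D_le[of j] show "x \<in> insert None (Some ` {..<length S})"
      by (cases "D K ! j") auto
  qed
  then have decodes: "decodes_to (decoder A K) S S' u (map decoded (D K))"
    using Y length_D unfolding decodes_to_def runs_on_def by auto
  have "real u \<le> real K * (real (nat \<lfloor>b\<rfloor>) + 10 * real (length S + length S' + 1))
      + 20 * real (length S + length S' + 1)"
    using u by (metis of_nat_add of_nat_le_iff of_nat_mult of_nat_numeral)
  \<comment> \<open>Since \<open>K\<close> is at least 1, the cost outside the rounds is absorbed
    into the factor \<open>K\<close>; this gives \<open>200 + 10 + 20 = 230\<close>.\<close>
  also have "\<dots> \<le> real K * (b + 10 * real (length S + length S' + 1))
      + real K * (20 * real (length S + length S' + 1))"
    using b pos(4) by (intro add_mono mult_left_mono) auto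
  also have "\<dots> = real K * (\<tau> (1 + \<gamma>) n + 230 * real (length S + length S' + 1))"
    by (simp add: b_def algebra_simps)
  also have "\<dots> \<le> real K * (\<tau> (1 + \<gamma>) n + 230 * ((2 + \<gamma>) * real n + 1))"
    using m lenS by (intro mult_left_mono add_left_mono) (simp_all add: algebra_simps)
  finally have time: "real u \<le> real K * (\<tau> (1 + \<gamma>) n + 230 * ((2 + \<gamma>) * real n + 1))" .
  have "real (card (misdecodings n Del Ins (map decoded (D K))))
      \<le> real (card undecoded) + real K * (\<epsilon>s * real n)"
    using card_misdecodings_le[of \<epsilon>s fst] T(3) pos(3) lenS fstS by simp
  also have "\<dots> \<le> real n * ((1 + \<gamma>) / (real K * (1 + \<epsilon>I)) + \<epsilon>I * (1 + \<gamma> / 2) / (1 + \<epsilon>I))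
      + real K * (\<epsilon>s * real n)"
    using card_undecoded_le[of \<gamma>] pos m lenS by simp
  also have "\<dots> = real n * ((1 + \<gamma>) / (real K * (1 + \<epsilon>I)) + \<epsilon>I * (1 + \<gamma> / 2) / (1 + \<epsilon>I) + real K * \<epsilon>s)"
    by (simp only: distrib_left) (simp add: mult.commute mult.left_commute)
  finally have mis: "real (card (misdecodings n Del Ins (map decoded (D K)))) \<le> real n *
      ((1 + \<gamma>) / (real K * (1 + \<epsilon>I)) + \<epsilon>I * (1 + \<gamma> / 2) / (1 + \<epsilon>I) + real K * \<epsilon>s)" .
  have "card {j. j < length S' \<and> map decoded (D K) ! j = Some i} \<le> K" for i
  proof -
    have "decoded x = Some i \<longleftrightarrow> x = Suc i" for x by (cases x) auto
    then have "map decoded (D K) ! j = Some i \<longleftrightarrow> D K ! j = Suc i" if "j < length S'" for j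
      using that length_D[of K] by simp
    then have "{j. j < length S' \<and> map decoded (D K) ! j = Some i} = {j. j < length S' \<and> D K ! j = Suc i}"
      by blast
    then show ?thesis using card_decoded_le[of i] by simp
  qed
  with decodes time mis show ?thesis
    by (intro exI[of _ u] exI[of _ "map decoded (D K)"] conjI allI impI)
qed

theorem theorem7p1:
  fixes \<epsilon>I \<gamma> :: real and \<tau> :: "real \<Rightarrow> nat \<Rightarrow> real"
  assumes "0 < \<epsilon>I" and "\<epsilon>I < 1" and "0 \<le> \<gamma>" and "\<And>r. near_linear (\<tau> r)"
  shows "\<exists>\<tau>'. near_linear \<tau>' \<and>
    (\<forall>(\<epsilon>s::real) (\<delta>::real) (\<Sigma>I :: nat set) (A :: com) (K :: nat).
       0 \<le> \<epsilon>s \<and> 0 \<le> \<delta> \<and> \<delta> < 1 \<and> finite \<Sigma>I \<and> K > 0 \<longrightarrow>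
       (\<exists>D :: com. \<forall>(n :: nat) (T :: nat list) (I :: nat list) S.
          length T = n \<and> length I = n \<and> sync_string \<epsilon>s T \<and>
          indexing_sequence \<epsilon>I \<tau> \<Sigma>I I A \<and> S = zip T I \<longrightarrow>
          (\<forall>S' Del Ins. set S' \<subseteq> UNIV \<times> \<Sigma>I \<and> channel \<delta> \<gamma> S S' Del Ins \<longrightarrow>
             (\<exists>t dec. decodes_to D S S' t dec \<and>
                real t \<le> real K * \<tau>' n \<and>
                real (card (misdecodings n Del Ins dec))
                  \<le> real n * ((1 + \<gamma>) / (real K * (1 + \<epsilon>I))
                              + \<epsilon>I * (1 + \<gamma> / 2) / (1 + \<epsilon>I) + real K * \<epsilon>s) \<and>
                (\<forall>i<n. card {j. j < length S' \<and> dec ! j = Some i} \<le> K)))))"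
\<comment> \<open>The received string has length at most \<open>(1 + \<gamma>) * n\<close>, hence
  the argument of \<open>\<tau>\<close>; the two strings together have length at most
  \<open>(2 + \<gamma>) * n\<close>.\<close>
proof (intro exI[of _ "\<lambda>n. \<tau> (1 + \<gamma>) n + 230 * ((2 + \<gamma>) * real n + 1)"] conjI allI impI)
  show "near_linear (\<lambda>n. \<tau> (1 + \<gamma>) n + 230 * ((2 + \<gamma>) * real n + 1))"
    using assms(4) by (rule near_linear_add_affine)
next
  fix \<epsilon>s \<delta> :: real and \<Sigma>I :: "nat set" and A :: com and K :: nat
  assume "0 \<le> \<epsilon>s \<and> 0 \<le> \<delta> \<and> \<delta> < 1 \<and> finite \<Sigma>I \<and> K > 0"
  then show "\<exists>D :: com. \<forall>(n :: nat) (T :: nat list) (I :: nat list) S.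
      length T = n \<and> length I = n \<and> sync_string \<epsilon>s T \<and>
      indexing_sequence \<epsilon>I \<tau> \<Sigma>I I A \<and> S = zip T I \<longrightarrow>
      (\<forall>S' Del Ins. set S' \<subseteq> UNIV \<times> \<Sigma>I \<and> channel \<delta> \<gamma> S S' Del Ins \<longrightarrow>
         (\<exists>t dec. decodes_to D S S' t dec \<and>
            real t \<le> real K * (\<tau> (1 + \<gamma>) n + 230 * ((2 + \<gamma>) * real n + 1)) \<and>
            real (card (misdecodings n Del Ins dec))
              \<le> real n * ((1 + \<gamma>) / (real K * (1 + \<epsilon>I))
                          + \<epsilon>I * (1 + \<gamma> / 2) / (1 + \<epsilon>I) + real K * \<epsilon>s) \<and>
            (\<forall>i<n. card {j. j < length S' \<and> dec ! j = Some i} \<le> K)))"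
    \<comment> \<open>The program depends only on \<open>A\<close> and \<open>K\<close>, so one
      decoder serves all \<open>n\<close>, \<open>T\<close> and \<open>I\<close>.\<close>
    using assms(1,3) by (intro exI[of _ "decoder A K"] allI impI decoder_correct) auto
qed

end
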